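(* Let $\Bbbk$ be an algebraically closed field of characteristic zero, let $\mathfrak g$ be a finite-dimensional simple Lie algebra over $\Bbbk$, and let $A$ be a commutative associative $\Bbbk$-algebra with identity. Then the bracket width of the current Lie algebra $\mathfrak g\otimes_{\Bbbk} A$ is less than or equal to $2$.
   Context: The current Lie algebra $\mathfrak g\otimes_{\Bbbk}A$ is the tensor product with bracket $[x\otimes a, y\otimes b]=[x,y]\otimes ab$. For a Lie algebra $L$, the length $\ell(z)$ of $z\in[L,L]$ is the smallest $n$ such that $z=\sum_{i=1}^n [x_i,y_i]$ with $x_i,y_i\in L$; the bracket width of $L$ is the supremum of $\ell(z)$ over $z\in[L,L]$. *)

theory Defs
  imports Main "HOL-Library.Poly_Mapping" "HOL-Library.Extended_Nat" "HOL-Computational_Algebra.Polynomial"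
begin

definition alg_closed :: "'k::field itself \<Rightarrow> bool" where
  "alg_closed _ \<longleftrightarrow> (\<forall>p::'k poly. degree p > 0 \<longrightarrow> (\<exists>x. poly p x = 0))"

definition lie_algebra ::
  "('k::field \<Rightarrow> 'g::ab_group_add \<Rightarrow> 'g) \<Rightarrow> ('g \<Rightarrow> 'g \<Rightarrow> 'g) \<Rightarrow> bool" where
  "lie_algebra sg br \<longleftrightarrow> vector_space sg
     \<and> (\<forall>x y z. br (x + y) z = br x z + br y z)
     \<and> (\<forall>x y z. br x (y + z) = br x y + br x z)
     \<and> (\<forall>c x y. br (sg c x) y = sg c (br x y))
     \<and> (\<forall>c x y. br x (sg c y) = sg c (br x y))
     \<and> (\<forall>x. br x x = 0)
     \<and> (\<forall>x y z. br x (br y z) + br y (br z x) + br z (br x y) = 0)"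

definition lie_ideal ::
  "('k::field \<Rightarrow> 'g::ab_group_add \<Rightarrow> 'g) \<Rightarrow> ('g \<Rightarrow> 'g \<Rightarrow> 'g) \<Rightarrow> 'g set \<Rightarrow> bool" where
  "lie_ideal sg br I \<longleftrightarrow> module.subspace sg I \<and> (\<forall>x y. y \<in> I \<longrightarrow> br x y \<in> I)"

definition simple_lie_algebra ::
  "('k::field \<Rightarrow> 'g::ab_group_add \<Rightarrow> 'g) \<Rightarrow> ('g \<Rightarrow> 'g \<Rightarrow> 'g) \<Rightarrow> bool" where
  "simple_lie_algebra sg br \<longleftrightarrow> lie_algebra sg br
     \<and> (\<exists>x y. br x y \<noteq> 0)
     \<and> (\<forall>I. lie_ideal sg br I \<longrightarrow> I = {0} \<or> I = UNIV)"

definition finite_dim ::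
  "('k::field \<Rightarrow> 'g::ab_group_add \<Rightarrow> 'g) \<Rightarrow> bool" where
  "finite_dim sg \<longleftrightarrow> (\<exists>B. finite_dimensional_vector_space sg B)"

definition comm_unital_algebra ::
  "('k::field \<Rightarrow> 'a::comm_ring \<Rightarrow> 'a) \<Rightarrow> bool" where
  "comm_unital_algebra sA \<longleftrightarrow> vector_space sA
     \<and> (\<forall>(c::'k) (x::'a) (y::'a). sA c (x * y) = sA c x * y)
     \<and> (\<exists>e::'a. \<forall>x::'a. e * x = x)"

text \<open>g \<otimes>_k A is the free abelian group on g \<times> A (finitely supported integer
  combinations) modulo the subgroup generated by the bilinearity and balancing relations.\<close>
inductive_set tensor_rels ::
  "('k::field \<Rightarrow> 'g::ab_group_add \<Rightarrow> 'g) \<Rightarrow> ('k \<Rightarrow> 'a::comm_ring \<Rightarrow> 'a)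
   \<Rightarrow> (('g \<times> 'a) \<Rightarrow>\<^sub>0 int) set"
  for sg sA where
  zero: "0 \<in> tensor_rels sg sA"
| add_l: "Poly_Mapping.single (x + y, a) 1 - Poly_Mapping.single (x, a) 1
           - Poly_Mapping.single (y, a) 1 \<in> tensor_rels sg sA"
| add_r: "Poly_Mapping.single (x, a + b) 1 - Poly_Mapping.single (x, a) 1
           - Poly_Mapping.single (x, b) 1 \<in> tensor_rels sg sA"
| scal: "Poly_Mapping.single (sg c x, a) 1 - Poly_Mapping.single (x, sA c a) 1
           \<in> tensor_rels sg sA"
| plus: "p \<in> tensor_rels sg sA \<Longrightarrow> q \<in> tensor_rels sg sA \<Longrightarrow> p + q \<in> tensor_rels sg sA"
| uminus: "p \<in> tensor_rels sg sA \<Longrightarrow> - p \<in> tensor_rels sg sA"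

definition tensor_eq ::
  "('k::field \<Rightarrow> 'g::ab_group_add \<Rightarrow> 'g) \<Rightarrow> ('k \<Rightarrow> 'a::comm_ring \<Rightarrow> 'a)
   \<Rightarrow> (('g \<times> 'a) \<Rightarrow>\<^sub>0 int) \<Rightarrow> (('g \<times> 'a) \<Rightarrow>\<^sub>0 int) \<Rightarrow> bool" where
  "tensor_eq sg sA p q \<longleftrightarrow> p - q \<in> tensor_rels sg sA"

text \<open>The current bracket [x \<otimes> a, y \<otimes> b] = [x,y] \<otimes> ab, extended biadditively
  to representatives.\<close>
definition current_bracket ::
  "('g \<Rightarrow> 'g \<Rightarrow> 'g) \<Rightarrow> (('g \<times> 'a::comm_ring) \<Rightarrow>\<^sub>0 int) \<Rightarrow> (('g \<times> 'a) \<Rightarrow>\<^sub>0 int)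
   \<Rightarrow> (('g \<times> 'a) \<Rightarrow>\<^sub>0 int)" where
  "current_bracket br p q =
     (\<Sum>u\<in>Poly_Mapping.keys p. \<Sum>v\<in>Poly_Mapping.keys q.
        Poly_Mapping.single (br (fst u) (fst v), snd u * snd v) (Poly_Mapping.lookup p u * Poly_Mapping.lookup q v))"

section \<open>Bracket length and bracket width (for a Lie algebra given by representatives,
  an equality relation and a bracket)\<close>

definition is_sum_of_brackets :: "('l \<Rightarrow> 'l \<Rightarrow> bool) \<Rightarrow> ('l \<Rightarrow> 'l \<Rightarrow> 'l::comm_monoid_add)
   \<Rightarrow> 'l \<Rightarrow> nat \<Rightarrow> bool" where
  "is_sum_of_brackets eq br z n \<longleftrightarrow> (\<exists>x y. eq z (\<Sum>i<n. br (x i) (y i)))"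

definition derived_set :: "('l \<Rightarrow> 'l \<Rightarrow> bool) \<Rightarrow> ('l \<Rightarrow> 'l \<Rightarrow> 'l::comm_monoid_add) \<Rightarrow> 'l set" where
  "derived_set eq br = {z. \<exists>n. is_sum_of_brackets eq br z n}"

definition bracket_length :: "('l \<Rightarrow> 'l \<Rightarrow> bool) \<Rightarrow> ('l \<Rightarrow> 'l \<Rightarrow> 'l::comm_monoid_add) \<Rightarrow> 'l \<Rightarrow> nat" where
  "bracket_length eq br z = (LEAST n. is_sum_of_brackets eq br z n)"

definition bracket_width :: "('l \<Rightarrow> 'l \<Rightarrow> bool) \<Rightarrow> ('l \<Rightarrow> 'l \<Rightarrow> 'l::comm_monoid_add) \<Rightarrow> enat" where
  "bracket_width eq br = (SUP z\<in>derived_set eq br. enat (bracket_length eq br z))"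

end

theory Submission
  imports Defs
begin

text \<open>
  It suffices to find \<open>x, y\<close> in the simple Lie algebra \<open>g\<close> with \<open>[x,g] + [y,g] = g\<close>:
  then every element of \<open>g \<otimes> A\<close> has the form \<open>[x \<otimes> 1, q] + [y \<otimes> 1, r]\<close>.

  Take \<open>x\<close> such that the generalized null space \<open>H\<close> of \<open>ad x\<close> has minimal dimension. Then
  \<open>H\<close> acts on itself by nilpotent maps, and \<open>g\<close> is the direct sum of the generalized weight
  spaces of \<open>H\<close>. The weights are linear, because they are normalized traces.

  For \<open>e, f\<close> in opposite root spaces, all weights take at \<open>[e,f]\<close> rational multiples of one
  value, by a trace computation along root strings. If the Killing form were zero, all weights
  would therefore vanish at all such \<open>[e,f]\<close>, hence on \<open>H\<close> because \<open>g\<close> is perfect; then \<open>g\<close>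
  would be ad-nilpotent, contradicting Engel's theorem. So the Killing form is nondegenerate, and
  \<open>[x,g] + [y,g] = g\<close> means that \<open>x\<close> and \<open>y\<close> have trivial common centralizer.

  Let \<open>y\<close> be a sum of nonzero vectors, one from each root space. An element \<open>z\<close> centralizing
  \<open>x\<close> and \<open>y\<close> lies in \<open>H\<close> and is annihilated by all weights, so it is orthogonal to \<open>g\<close>,
  and \<open>z = 0\<close>. This needs neither that \<open>H\<close> is abelian nor that root spaces are lines.
\<close>

section \<open>Linear algebra\<close>

context finite_dimensional_vector_space
begin

section \<open>Elementary calculus of linear endomorphisms\<close>

abbreviation endo :: "('b \<Rightarrow> 'b) \<Rightarrow> bool" where
  "endo \<equiv> Vector_Spaces.linear scale scale"

lemma endoI:
  assumes "\<And>x y. f (x + y) = f x + f y" "\<And>c x. f (c *s x) = c *s f x"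
  shows "endo f"
  unfolding Vector_Spaces.linear_iff using assms vector_space_axioms by simp

lemma endo_add: "endo f \<Longrightarrow> f (x + y) = f x + f y"
  and endo_scale: "endo f \<Longrightarrow> f (c *s x) = c *s f x"
  by (simp_all add: Vector_Spaces.linear_iff)

lemma endo_zero: "endo f \<Longrightarrow> f 0 = 0"
  by (metis endo_scale scale_zero_left)

lemma endo_neg: "endo f \<Longrightarrow> f (- x) = - f x"
  by (metis endo_scale scale_minus_left scale_one)

lemma endo_diff: "endo f \<Longrightarrow> f (x - y) = f x - f y"
  by (metis add_uminus_conv_diff endo_add endo_neg)

lemma endo_sum: "endo f \<Longrightarrow> f (sum g A) = (\<Sum>i\<in>A. f (g i))"
  by (induction A rule: infinite_finite_induct) (auto simp: endo_zero endo_add)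

lemma endo_comp: "endo f \<Longrightarrow> endo g \<Longrightarrow> endo (\<lambda>v. f (g v))"
  by (intro endoI) (simp_all add: endo_add endo_scale)

lemma endo_plus: "endo f \<Longrightarrow> endo g \<Longrightarrow> endo (\<lambda>v. f v + g v)"
  by (intro endoI) (simp_all add: endo_add endo_scale scale_right_distrib)

lemma endo_minus: "endo f \<Longrightarrow> endo g \<Longrightarrow> endo (\<lambda>v. f v - g v)"
  by (intro endoI) (simp_all add: endo_add endo_scale scale_right_diff_distrib)

lemma endo_smult: "endo f \<Longrightarrow> endo (\<lambda>v. c *s f v)"
  by (intro endoI) (simp_all add: endo_add endo_scale scale_right_distrib mult.commute)

lemma endo_ident: "endo (\<lambda>v. v)"
  by (intro endoI) simp_all

lemma endo_sumI: "(\<And>i. i \<in> A \<Longrightarrow> endo (f i)) \<Longrightarrow> endo (\<lambda>v. \<Sum>i\<in>A. f i v)"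
  by (intro endoI) (simp_all add: endo_add endo_scale sum.distrib scale_sum_right)

lemma endo_shift: "endo f \<Longrightarrow> endo (\<lambda>v. f v - c *s v)"
  by (intro endo_minus endo_smult endo_ident)

lemma endo_funpow: "endo f \<Longrightarrow> endo (f ^^ k)"
proof (induction k)
  case (Suc k)
  then show ?case using endo_comp[of f "f ^^ k"] by (simp add: o_def)
qed (simp add: endo_ident id_def)

lemma funpow_stable: "f ` W \<subseteq> W \<Longrightarrow> v \<in> W \<Longrightarrow> (f ^^ k) v \<in> W"
  by (induction k) auto

lemma subspace_endo_image: "endo f \<Longrightarrow> subspace W \<Longrightarrow> subspace (f ` W)"
proof (rule subspaceI)
  assume f: "endo f" and W: "subspace W"
  show "0 \<in> f ` W" using endo_zero[OF f] subspace_0[OF W] by force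
  show "x + y \<in> f ` W" if "x \<in> f ` W" "y \<in> f ` W" for x y
    using that endo_add[OF f] subspace_add[OF W] by (metis (no_types, lifting) image_iff)
  show "c *s x \<in> f ` W" if "x \<in> f ` W" for c x
    using that endo_scale[OF f] subspace_scale[OF W] by (metis (no_types, lifting) image_iff)
qed

lemma subspace_endo_kernel: "endo f \<Longrightarrow> subspace {v. f v = 0}"
  by (intro subspaceI) (auto simp: endo_zero endo_add endo_scale)

lemma subspace_psubset_dim: "subspace S \<Longrightarrow> subspace T \<Longrightarrow> S \<subset> T \<Longrightarrow> dim S < dim T"
  by (metis dim_psubset span_eq_iff)

lemma linear_projection_exists:
  assumes "subspace W"
  obtains p where "endo p" "\<And>v. p v \<in> W" "\<And>v. v \<in> W \<Longrightarrow> p v = v"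
proof -
  interpret vp: vector_space_pair scale scale by unfold_locales
  obtain p where "p ` UNIV \<subseteq> W" "endo p" "\<forall>v\<in>W. p v = v"
    using vp.linear_exists_left_inverse_on[OF endo_ident assms] by auto
  then show ?thesis using that by blast
qed

subsection \<open>Generalized eigenspaces\<close>

definition geneig :: "('b \<Rightarrow> 'b) \<Rightarrow> 'a \<Rightarrow> 'b set" where
  "geneig T c = {v. \<exists>k. ((\<lambda>v. T v - c *s v) ^^ k) v = 0}"

lemma funpow_zero_mono:
  assumes "endo N" "(N ^^ k) v = 0" "k \<le> l"
  shows "(N ^^ l) v = 0"
proof -
  obtain m where "l = m + k" using assms(3) by (metis add.commute le_Suc_ex)
  then show ?thesis using assms endo_zero[OF endo_funpow[OF assms(1)]] by (simp add: funpow_add)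
qed

lemma geneigI: "((\<lambda>v. T v - c *s v) ^^ k) v = 0 \<Longrightarrow> v \<in> geneig T c"
  unfolding geneig_def by blast

lemma geneig_eigenvector: "T v = c *s v \<Longrightarrow> v \<in> geneig T c"
  by (rule geneigI[where k = 1]) simp

lemma subspace_geneig:
  assumes "endo T"
  shows "subspace (geneig T c)"
proof (rule subspaceI)
  let ?N = "\<lambda>v. T v - c *s v"
  note N = endo_shift[OF assms, of c]
  show "0 \<in> geneig T c" by (rule geneigI[where k = 0]) simp
  show "x + y \<in> geneig T c" if xy: "x \<in> geneig T c" "y \<in> geneig T c" for x y
  proof -
    obtain k l where "(?N ^^ k) x = 0" "(?N ^^ l) y = 0" using xy unfolding geneig_def by blast
    then have "(?N ^^ (max k l)) (x + y) = 0"
      using funpow_zero_mono[OF N, of k x "max k l"] funpow_zero_mono[OF N, of l y "max k l"]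
      by (simp add: endo_add[OF endo_funpow[OF N]])
    then show ?thesis by (rule geneigI)
  qed
  show "a *s x \<in> geneig T c" if "x \<in> geneig T c" for a x
    using that unfolding geneig_def by (auto simp: endo_scale[OF endo_funpow[OF N]])
qed

text \<open>\<open>T - c\<close> acts on a \<open>d\<close>-eigenvector as the scalar
  \<open>d - c\<close>, and a nonzero scalar is not nilpotent.\<close>

lemma geneig_eigenvalue_unique:
  assumes "endo T" "v \<in> geneig T c" "T v = d *s v" "v \<noteq> 0"
  shows "d = c"
proof -
  obtain k where k: "((\<lambda>v. T v - c *s v) ^^ k) v = 0" using assms(2) unfolding geneig_def by blast
  have "((\<lambda>v. T v - c *s v) ^^ j) v = (d - c) ^ j *s v" for j
    by (induction j)
      (simp_all add: endo_scale[OF assms(1)] assms(3) scale_left_diff_distrib scale_right_diff_distrib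
         algebra_simps)
  then show ?thesis using k assms(4) by simp
qed

text \<open>If \<open>m\<close> is the first power of \<open>N\<close> killing \<open>v\<close>, the
  kernels of \<open>N ^^ j\<close> grow strictly up to \<open>j = m\<close>, so \<open>m\<close> is
  at most the dimension. This gives one exponent that serves all operators and vectors.\<close>

lemma funpow_dim_zero:
  assumes N: "endo N" and "(N ^^ k) v = 0"
  shows "(N ^^ dimension) v = 0"
proof (rule ccontr)
  assume *: "(N ^^ dimension) v \<noteq> 0"
  define m where "m = (LEAST k. (N ^^ k) v = 0)"
  have m0: "(N ^^ m) v = 0" unfolding m_def using assms(2) by (rule LeastI)
  have ml: "(N ^^ j) v \<noteq> 0" if "j < m" for j using that unfolding m_def by (rule not_less_Least)
  have "dimension < m" using * funpow_zero_mono[OF N m0] by (meson not_less)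
  have "j \<le> dim {w. (N ^^ j) w = 0}" if "j \<le> m" for j
    using that
  proof (induction j)
    case (Suc j)
    \<comment> \<open>This vector separates two consecutive kernels: \<open>N ^^ j\<close> sends it
      to the last nonzero iterate of \<open>v\<close>.\<close>
    let ?w = "(N ^^ (m - Suc j)) v"
    have "(N ^^ a) ((N ^^ b) v) = (N ^^ (a + b)) v" for a b by (simp add: funpow_add)
    then have "(N ^^ Suc j) ?w = (N ^^ m) v" "(N ^^ j) ?w = (N ^^ (m - 1)) v"
      using Suc.prems by (simp_all del: funpow.simps)
    then have "?w \<in> {w. (N ^^ Suc j) w = 0}" "?w \<notin> {w. (N ^^ j) w = 0}"
      using m0 ml[of "m - 1"] Suc.prems by auto
    moreover have "{w. (N ^^ j) w = 0} \<subseteq> {w. (N ^^ Suc j) w = 0}"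
      by (auto simp: endo_zero[OF N])
    ultimately have "{w. (N ^^ j) w = 0} \<subset> {w. (N ^^ Suc j) w = 0}" by blast
    then have "dim {w. (N ^^ j) w = 0} < dim {w. (N ^^ Suc j) w = 0}"
      by (intro subspace_psubset_dim subspace_endo_kernel endo_funpow N)
    then show ?case using Suc by simp
  qed simp
  from this[of m] show False using \<open>dimension < m\<close> dim_subset_UNIV by (metis le_trans not_le order_refl)
qed

text \<open>Split a linear factor off an annihilating polynomial of \<open>v\<close> of least degree.\<close>

lemma eigenvector_exists:
  assumes ac: "alg_closed TYPE('a)" and T: "endo T" and W: "subspace W" "T ` W \<subseteq> W" "W \<noteq> {0}"
  obtains c v where "v \<in> W" "v \<noteq> 0" "T v = c *s v"
proof -
  \<comment> \<open>Evaluation of the polynomial \<open>p\<close> at the operator \<open>T\<close>,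
    applied to \<open>v\<close>.\<close>
  define ev where "ev p v = (\<Sum>i\<le>degree p. coeff p i *s (T ^^ i) v)" for p v
  have ev_pCons: "ev (pCons a p) v = a *s v + T (ev p v)" for a p v
    by (cases "p = 0")
      (simp_all add: ev_def sum.atMost_Suc_shift endo_sum[OF T] endo_scale[OF T] endo_zero[OF T]
         del: sum.atMost_Suc)
  have ev_smult: "ev (smult a p) v = a *s ev p v" for a p v
    by (cases "a = 0") (simp_all add: ev_def scale_sum_right)
  have ev_add: "ev (p + q) v = ev p v + ev q v" for p q v
  proof (induction p q rule: poly_induct2)
    case (pCons a p b q)
    then show ?case by (simp add: ev_pCons endo_add[OF T] scale_left_distrib)
  qed (simp add: ev_def)
  have ev_W: "ev p v \<in> W" if "v \<in> W" for p v
    unfolding ev_def by (intro subspace_sum subspace_scale funpow_stable W that)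
  obtain v where v: "v \<in> W" "v \<noteq> 0" using W subspace_0 by blast
  \<comment> \<open>If the \<open>dimension + 1\<close> iterates of \<open>v\<close> are distinct,
    they are linearly dependent and a relation gives the coefficients of \<open>p\<close>; a
    repetition gives a difference of two monomials.\<close>
  have "\<exists>p. p \<noteq> 0 \<and> ev p v = 0"
  proof (cases "inj_on (\<lambda>i. (T ^^ i) v) {..dimension}")
    case True
    let ?S = "(\<lambda>i. (T ^^ i) v) ` {..dimension}"
    have "dim ?S < card ?S"
      using dim_subset_UNIV[of ?S] True by (simp add: card_image)
    then have "dependent ?S" by (metis dependent_biggerset_general finite_imageI finite_atMost)
    then obtain u where u: "(\<Sum>w\<in>?S. u w *s w) = 0" "\<exists>w\<in>?S. u w \<noteq> 0"
      using dependent_finite[of ?S] by auto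
    define p where "p = (\<Sum>i\<le>dimension. monom (u ((T ^^ i) v)) i)"
    have cp: "coeff p i = (if i \<le> dimension then u ((T ^^ i) v) else 0)" for i
      unfolding p_def by (simp add: coeff_sum)
    have "degree p \<le> dimension" by (intro degree_le) (simp add: cp)
    have "ev p v = (\<Sum>i\<le>dimension. coeff p i *s (T ^^ i) v)"
      unfolding ev_def using \<open>degree p \<le> dimension\<close>
      by (intro sum.mono_neutral_left) (auto simp: coeff_eq_0)
    also have "\<dots> = (\<Sum>w\<in>?S. u w *s w)"
      using True by (simp add: sum.reindex cp)
    finally have "ev p v = 0" using u by simp
    moreover have "p \<noteq> 0" using u(2) cp by (auto simp: poly_eq_iff)
    ultimately show ?thesis by blast
  next
    case False
    then obtain i j where ij: "(T ^^ i) v = (T ^^ j) v" "i \<noteq> j" by (auto simp: inj_on_def)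
    have ev_monom: "ev (monom 1 i) v = (T ^^ i) v" for i
    proof (induction i)
      case 0
      show ?case by (simp add: ev_def monom_0)
    next
      case (Suc i)
      then show ?case by (simp add: monom_Suc ev_pCons)
    qed
    have "ev (monom 1 i + smult (-1) (monom 1 j)) v = 0"
      unfolding ev_add ev_smult ev_monom using ij by simp
    moreover have "coeff (monom 1 i + smult (-1) (monom (1::'a) j)) i = 1"
      using ij(2) by simp
    then have "monom 1 i + smult (-1) (monom (1::'a) j) \<noteq> 0" by (metis coeff_0 zero_neq_one)
    ultimately show ?thesis by blast
  qed
  then obtain p where p: "p \<noteq> 0" "ev p v = 0"
    and least: "\<And>q. q \<noteq> 0 \<Longrightarrow> ev q v = 0 \<Longrightarrow> degree p \<le> degree q"
    using ex_has_least_nat[of "\<lambda>p. p \<noteq> 0 \<and> ev p v = 0" _ degree] by blast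
  have "degree p > 0"
  proof (rule ccontr)
    assume "\<not> degree p > 0"
    then have "ev p v = coeff p 0 *s v" "coeff p 0 \<noteq> 0"
      using p(1) leading_coeff_0_iff[of p] by (auto simp: ev_def)
    then show False using p v by simp
  qed
  then obtain c where "poly p c = 0" using ac unfolding alg_closed_def by blast
  then obtain q where q: "p = [:- c, 1:] * q" by (metis poly_eq_0_iff_dvd dvdE)
  have "q \<noteq> 0" using q p by auto
  then have "degree q < degree p" unfolding q by (subst degree_mult_eq) auto
  then have "ev q v \<noteq> 0" using least[OF \<open>q \<noteq> 0\<close>] by fastforce
  have "p = smult (- c) q + pCons 0 q" unfolding q by simp
  then have "ev p v = - c *s ev q v + T (ev q v)"
    using ev_add[of "smult (- c) q" "pCons 0 q" v] ev_smult[of "- c" q v] ev_pCons[of 0 q v] by simp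
  then have "T (ev q v) = c *s ev q v" using p(2) by simp
  then show ?thesis using that[of "ev q v" c] ev_W[OF v(1)] \<open>ev q v \<noteq> 0\<close> by blast
qed

text \<open>In a basis of \<open>W\<close> that contains \<open>v\<close>, the images of the other
  members already span the image of \<open>W\<close>.\<close>

lemma dim_image_less:
  assumes N: "endo N" and W: "subspace W" and v: "v \<in> W" "v \<noteq> 0" "N v = 0"
  shows "dim (N ` W) < dim W"
proof -
  obtain B where B: "{v} \<subseteq> B" "B \<subseteq> W" "independent B" "W \<subseteq> span B"
    using maximal_independent_subset_extend[of "{v}" W] v by auto
  have fin: "finite B" using B(3) by (rule finiteI_independent)
  interpret vp: vector_space_pair scale scale by unfold_locales
  have "N ` W \<subseteq> N ` span B" using B by blast
  also have "\<dots> = span (N ` B)" using vp.linear_span_image[OF N] by simp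
  also have "N ` B = insert 0 (N ` (B - {v}))" using B v(3) by auto
  finally have "N ` W \<subseteq> span (N ` (B - {v}))" by simp
  then have "dim (N ` W) \<le> card (N ` (B - {v}))" using fin by (intro dim_le_card) auto
  also have "\<dots> \<le> card (B - {v})" using fin by (intro card_image_le) auto
  also have "\<dots> < card B" using fin B by (intro psubset_card_mono) auto
  also have "card B = dim W" using B by (intro basis_card_eq_dim)
  finally show ?thesis .
qed

text \<open>The images of the powers of \<open>N\<close> stop shrinking. Once \<open>N ^^ k\<close>
  and its square have the same image on \<open>W\<close>, each \<open>w\<close> splits into a part
  in that image and a part killed by \<open>N ^^ k\<close>.\<close>

lemma fitting_decomposition:
  assumes N: "endo N" and W: "subspace W" "N ` W \<subseteq> W"
  obtains k where "k > 0" "\<And>w. w \<in> W \<Longrightarrow> \<exists>w'\<in>W. (N ^^ k) (w - (N ^^ k) w') = 0"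
proof -
  obtain l where l: "\<And>m. dim ((N ^^ l) ` W) \<le> dim ((N ^^ m) ` W)"
    using ex_has_least_nat[of "\<lambda>_. True" 0 "\<lambda>l. dim ((N ^^ l) ` W)"] by blast
  \<comment> \<open>The successor keeps the minimal image dimension and makes the exponent positive,
    so that \<open>N ^^ k\<close> kills whatever \<open>N\<close> kills.\<close>
  define k where "k = Suc l"
  have image_mono: "(N ^^ (a + b)) ` W \<subseteq> (N ^^ a) ` W" for a b
    using funpow_stable[OF W(2)] by (auto simp: funpow_add)
  have "dim ((N ^^ k) ` W) \<le> dim ((N ^^ l) ` W)"
    using dim_subset[OF image_mono[of l 1]] by (simp add: k_def)
  then have k: "dim ((N ^^ k) ` W) \<le> dim ((N ^^ (k + k)) ` W)"
    using l[of "k + k"] by simp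
  have eq: "(N ^^ (k + k)) ` W = (N ^^ k) ` W"
    by (intro subspace_dim_equal subspace_endo_image endo_funpow N W k image_mono)
  have "\<exists>w'\<in>W. (N ^^ k) (w - (N ^^ k) w') = 0" if "w \<in> W" for w
  proof -
    have "(N ^^ k) w \<in> (N ^^ (k + k)) ` W" using that eq by blast
    then show ?thesis by (auto simp: endo_diff[OF endo_funpow[OF N]] funpow_add)
  qed
  then show ?thesis using that[of k] by (simp add: k_def)
qed

text \<open>Induction on \<open>dim W\<close>: for an eigenvalue \<open>c\<close> on
  \<open>W\<close>, Fitting's decomposition for \<open>T - c\<close> splits \<open>W\<close> into a
  part inside \<open>geneig T c\<close> and a \<open>T\<close>-stable image, which is smaller
  because an eigenvector is killed.\<close>

lemma geneig_span:
  assumes ac: "alg_closed TYPE('a)" and T: "endo T"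
  shows "subspace W \<Longrightarrow> T ` W \<subseteq> W \<Longrightarrow> W \<subseteq> span (\<Union>c. W \<inter> geneig T c)"
proof (induction "dim W" arbitrary: W rule: less_induct)
  case less
  show ?case
  proof (cases "W = {0}")
    case False
    then obtain c v where v: "v \<in> W" "v \<noteq> 0" "T v = c *s v"
      using eigenvector_exists[OF ac T less.prems] by blast
    let ?N = "\<lambda>v. T v - c *s v"
    note N = endo_shift[OF T, of c]
    have NW: "?N ` W \<subseteq> W"
      using less.prems by (auto intro: subspace_diff subspace_scale)
    obtain k where k: "k > 0" "\<And>w. w \<in> W \<Longrightarrow> \<exists>w'\<in>W. (?N ^^ k) (w - (?N ^^ k) w') = 0"
      using fitting_decomposition[OF N less.prems(1) NW] by blast
    let ?U = "(?N ^^ k) ` W"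
    have comm: "T ((?N ^^ j) w) = (?N ^^ j) (T w)" for j w
      by (induction j) (simp_all add: endo_diff[OF T] endo_scale[OF T])
    have "(?N ^^ k) v = 0" using v k(1) by (rule_tac funpow_zero_mono[OF N, where k = 1]) auto
    then have "dim ?U < dim W" using dim_image_less[OF endo_funpow[OF N]] less.prems v by blast
    moreover have "subspace ?U" by (intro subspace_endo_image endo_funpow N less.prems)
    moreover have "T ` ?U \<subseteq> ?U" using less.prems(2) by (auto simp: comm)
    ultimately have U: "?U \<subseteq> span (\<Union>c. ?U \<inter> geneig T c)" by (rule less.hyps)
    have UW: "?U \<subseteq> W" using funpow_stable[OF NW] by blast
    have "span (\<Union>c. ?U \<inter> geneig T c) \<subseteq> span (\<Union>c. W \<inter> geneig T c)"
      using UW by (intro span_mono) blast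
    with U have U: "?U \<subseteq> span (\<Union>c. W \<inter> geneig T c)" by blast
    show ?thesis
    proof
      fix w assume w: "w \<in> W"
      then obtain a where a: "a \<in> W" "(?N ^^ k) (w - (?N ^^ k) a) = 0" using k by blast
      then have "w - (?N ^^ k) a \<in> W \<inter> geneig T c"
        using geneigI w UW less.prems(1) by (blast intro: subspace_diff)
      then have "w - (?N ^^ k) a \<in> span (\<Union>c. W \<inter> geneig T c)" by (blast intro: span_base)
      moreover have "(?N ^^ k) a \<in> span (\<Union>c. W \<inter> geneig T c)" using U a by blast
      ultimately have "w - (?N ^^ k) a + (?N ^^ k) a \<in> span (\<Union>c. W \<inter> geneig T c)" by (rule span_add)
      then show "w \<in> span (\<Union>c. W \<inter> geneig T c)" by simp
    qed
  qed (simp add: span_zero)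
qed

subsection \<open>Independent families of subspaces\<close>

text \<open>Testing finite subfamilies allows independence to be stated before the index set is
  known to be finite.\<close>

definition indep_family :: "'i set \<Rightarrow> ('i \<Rightarrow> 'b set) \<Rightarrow> bool" where
  "indep_family I W \<longleftrightarrow> (\<forall>F v. finite F \<longrightarrow> F \<subseteq> I \<longrightarrow> (\<forall>i\<in>F. v i \<in> W i) \<longrightarrow> sum v F = 0
      \<longrightarrow> (\<forall>i\<in>F. v i = 0))"

lemma indep_familyD:
  "indep_family I W \<Longrightarrow> finite F \<Longrightarrow> F \<subseteq> I \<Longrightarrow> (\<And>i. i \<in> F \<Longrightarrow> v i \<in> W i) \<Longrightarrow> sum v F = 0
     \<Longrightarrow> i \<in> F \<Longrightarrow> v i = 0"
  unfolding indep_family_def by blast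

text \<open>A high power of \<open>D\<close> removes the term \<open>v j\<close> from a vanishing
  sum but is injective on \<open>W i\<close>, so \<open>v i = 0\<close> follows from the shorter sum
  by induction.\<close>

lemma indep_family_separated:
  assumes sep: "\<And>i j. i \<in> I \<Longrightarrow> j \<in> I \<Longrightarrow> i \<noteq> j \<Longrightarrow> \<exists>D. endo D \<and> (\<forall>l\<in>I. D ` W l \<subseteq> W l)
      \<and> (\<forall>w\<in>W i. D w = 0 \<longrightarrow> w = 0) \<and> (\<forall>w\<in>W j. \<exists>k. (D ^^ k) w = 0)"
  shows "indep_family I W"
proof -
  have "\<forall>i\<in>F. v i = 0" if "finite F" "F \<subseteq> I" "\<forall>i\<in>F. v i \<in> W i" "sum v F = 0" for F v
    using that
  proof (induction F arbitrary: v rule: finite_induct)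
    case (insert j F)
    have *: "v i = 0" if i: "i \<in> F" for i
    proof -
      have "i \<in> I" "j \<in> I" "i \<noteq> j" using insert i by auto
      then obtain D where D: "endo D" "\<And>l. l \<in> I \<Longrightarrow> D ` W l \<subseteq> W l"
        "\<And>w. w \<in> W i \<Longrightarrow> D w = 0 \<Longrightarrow> w = 0" "\<And>w. w \<in> W j \<Longrightarrow> \<exists>k. (D ^^ k) w = 0"
        using sep[of i j] by blast
      obtain k where k: "(D ^^ k) (v j) = 0" using D(4) insert.prems by blast
      have "(D ^^ k) (sum v (insert j F)) = 0"
        using insert.prems(3) endo_zero[OF endo_funpow[OF D(1)]] by simp
      then have "(\<Sum>l\<in>F. (D ^^ k) (v l)) = 0"
        unfolding endo_sum[OF endo_funpow[OF D(1)]] using insert.hyps k by simp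
      moreover have "\<forall>l\<in>F. (D ^^ k) (v l) \<in> W l"
        using insert.prems D(2) funpow_stable by (metis insertCI subsetD)
      ultimately have zero: "(D ^^ k) (v i) = 0"
        using insert.IH[of "\<lambda>l. (D ^^ k) (v l)"] insert.prems(1) i by blast
      have inj: "(D ^^ m) w = 0 \<Longrightarrow> w \<in> W i \<Longrightarrow> w = 0" for m w
        using D(2)[OF \<open>i \<in> I\<close>] D(3) funpow_stable[of D "W i"] by (induction m) auto
      show ?thesis using inj[OF zero] insert.prems i by blast
    qed
    then show ?case using insert by simp
  qed simp
  then show ?thesis unfolding indep_family_def by blast
qed

text \<open>Nonzero vectors picked from distinct members are linearly independent, so there are at
  most \<open>dimension\<close> of them.\<close>

lemma indep_family_finite:
  assumes "indep_family I W" and nz: "\<And>i. i \<in> I \<Longrightarrow> \<exists>v\<in>W i. v \<noteq> 0"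
    and sub: "\<And>i. i \<in> I \<Longrightarrow> subspace (W i)"
  shows "finite I"
proof (rule ccontr)
  assume "infinite I"
  then obtain F where F: "finite F" "card F = Suc dimension" "F \<subseteq> I"
    by (meson infinite_arbitrarily_large)
  obtain v where v: "\<And>i. i \<in> I \<Longrightarrow> v i \<in> W i" "\<And>i. i \<in> I \<Longrightarrow> v i \<noteq> 0" using nz by metis
  have comb: "\<forall>i\<in>F. a i = 0" if "(\<Sum>i\<in>F. a i *s v i) = 0" for a
  proof
    fix i assume "i \<in> F"
    then have "a i *s v i = 0"
      using indep_familyD[OF assms(1) F(1,3), of "\<lambda>i. a i *s v i"] v sub F that
      by (meson subspace_scale subsetD)
    then show "a i = 0" using v F \<open>i \<in> F\<close> by auto
  qed
  have inj: "inj_on v F"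
  proof (rule inj_onI, rule ccontr)
    fix i j assume ij: "i \<in> F" "j \<in> F" "v i = v j" "i \<noteq> j"
    \<comment> \<open>Equal vectors at different indices would satisfy the relation with
      coefficients \<open>1\<close> and \<open>-1\<close>.\<close>
    let ?a = "\<lambda>l. if l = i then 1 else if l = j then -1 else 0"
    have "(\<Sum>l\<in>F. ?a l *s v l) = (\<Sum>l\<in>{i, j}. ?a l *s v l)"
      using ij F(1) by (intro sum.mono_neutral_right) auto
    also have "\<dots> = 0" using ij by simp
    finally show False using comb[of ?a] ij(1) by auto
  qed
  have "independent (v ` F)"
  proof (rule independent_if_scalars_zero)
    fix f x assume "(\<Sum>x\<in>v ` F. f x *s x) = 0" "x \<in> v ` F"
    then show "f x = 0" using comb[of "\<lambda>i. f (v i)"] by (auto simp: sum.reindex[OF inj])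
  qed (use F in auto)
  then have "card (v ` F) \<le> dimension"
    using independent_card_le_dim[of "v ` F" UNIV] by (simp add: dimension_def)
  then show False using F card_image[OF inj] by simp
qed

section \<open>Eigenvalues and pencils of operators\<close>

lemma finite_eigenvalues:
  assumes T: "endo T"
  shows "finite {c. \<exists>v. v \<noteq> 0 \<and> T v = c *s v}"
proof (rule indep_family_finite)
  let ?E = "\<lambda>c. {v. T v = c *s v}"
  show "indep_family {c. \<exists>v. v \<noteq> 0 \<and> T v = c *s v} ?E"
  proof (rule indep_family_separated)
    fix i j :: 'a assume "i \<noteq> j"
    show "\<exists>D. endo D \<and> (\<forall>l\<in>{c. \<exists>v. v \<noteq> 0 \<and> T v = c *s v}. D ` ?E l \<subseteq> ?E l)
      \<and> (\<forall>w\<in>?E i. D w = 0 \<longrightarrow> w = 0) \<and> (\<forall>w\<in>?E j. \<exists>k. (D ^^ k) w = 0)"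
      using \<open>i \<noteq> j\<close>
      by (intro exI[of _ "\<lambda>v. T v - j *s v"])
        (auto simp: endo_shift[OF T] endo_diff[OF T] endo_scale[OF T] scale_right_diff_distrib mult.commute
            intro: exI[of _ 1])
  qed
  show "subspace (?E c)" for c
    using subspace_endo_kernel[OF endo_shift[OF T, of c]] by simp
qed auto

text \<open>A left inverse \<open>C\<close> of \<open>B\<close> on \<open>M\<close> turns the
  equation into the eigenvalue equation \<open>C (A v) = t *s v\<close>.\<close>

lemma finite_pencil_eigenvalues:
  assumes A: "endo A" and B: "endo B" and M: "subspace M" and inj: "\<And>v. v \<in> M \<Longrightarrow> B v = 0 \<Longrightarrow> v = 0"
  shows "finite {t. \<exists>v\<in>M. v \<noteq> 0 \<and> A v = t *s B v}"
proof -
  interpret vp: vector_space_pair scale scale by unfold_locales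
  have "inj_on B M"
  proof (rule inj_onI)
    fix a b assume "a \<in> M" "b \<in> M" "B a = B b"
    then show "a = b" using inj[of "a - b"] subspace_diff[OF M] endo_diff[OF B] by simp
  qed
  then obtain C where C: "endo C" "\<And>v. v \<in> M \<Longrightarrow> C (B v) = v"
    using vp.linear_exists_left_inverse_on[OF B M] by blast
  have "{t. \<exists>v\<in>M. v \<noteq> 0 \<and> A v = t *s B v} \<subseteq> {c. \<exists>v. v \<noteq> 0 \<and> C (A v) = c *s v}"
    using C endo_scale[OF C(1)] by force
  then show ?thesis using finite_eigenvalues[OF endo_comp[OF C(1) A]] finite_subset by blast
qed

text \<open>The vectors \<open>w i\<close> are chosen before \<open>t\<close>, so the power of the
  pencil applied to \<open>v\<close> is a polynomial in \<open>t\<close> with vector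
  coefficients.\<close>

lemma pencil_power_expansion:
  assumes A: "endo A" and B: "endo B"
  shows "\<exists>w. \<forall>t. ((\<lambda>v. A v + t *s B v) ^^ n) v = (\<Sum>i\<le>n. t ^ i *s w i) \<and> w 0 = (A ^^ n) v"
proof (induction n)
  case 0
  show ?case by (rule exI[of _ "\<lambda>_. v"]) simp
next
  case (Suc n)
  then obtain w where w: "\<And>t. ((\<lambda>v. A v + t *s B v) ^^ n) v = (\<Sum>i\<le>n. t ^ i *s w i)" "w 0 = (A ^^ n) v"
    by blast
  \<comment> \<open>\<open>A\<close> keeps the degree in \<open>t\<close> and \<open>B\<close>
    raises it by one; the case distinctions put zero for coefficients out of range.\<close>
  define w' where "w' i = (if i \<le> n then A (w i) else 0) + (if i = 0 then 0 else B (w (i - 1)))" for i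
  have "((\<lambda>v. A v + t *s B v) ^^ Suc n) v = (\<Sum>i\<le>Suc n. t ^ i *s w' i)" for t
  proof -
    have "((\<lambda>v. A v + t *s B v) ^^ Suc n) v
        = (\<Sum>i\<le>n. t ^ i *s A (w i)) + (\<Sum>i\<le>n. t ^ Suc i *s B (w i))"
      by (simp add: w endo_sum[OF A] endo_sum[OF B] endo_scale[OF A] endo_scale[OF B] scale_sum_right)
    also have "(\<Sum>i\<le>n. t ^ i *s A (w i)) = (\<Sum>i\<le>Suc n. t ^ i *s (if i \<le> n then A (w i) else 0))"
      by simp
    also have "(\<Sum>i\<le>n. t ^ Suc i *s B (w i)) = (\<Sum>i\<le>Suc n. t ^ i *s (if i = 0 then 0 else B (w (i - 1))))"
      by (simp add: sum.atMost_Suc_shift del: sum.atMost_Suc)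
    finally show ?thesis by (simp only: w'_def scale_right_distrib sum.distrib)
  qed
  moreover have "w' 0 = (A ^^ Suc n) v" by (simp add: w'_def w)
  ultimately show ?case by blast
qed

text \<open>Each coordinate of the power is a polynomial in \<open>t\<close> with infinitely many
  zeros, hence zero; its constant coefficient is that coordinate of
  \<open>(A ^^ n) v\<close>.\<close>

lemma pencil_nilpotent_at_zero:
  assumes A: "endo A" and B: "endo B" and inf: "infinite S"
    and zero: "\<And>t. t \<in> S \<Longrightarrow> ((\<lambda>v. A v + t *s B v) ^^ n) v = 0"
  shows "(A ^^ n) v = 0"
proof -
  obtain w where w: "\<And>t. ((\<lambda>v. A v + t *s B v) ^^ n) v = (\<Sum>i\<le>n. t ^ i *s w i)" "w 0 = (A ^^ n) v"
    using pencil_power_expansion[OF A B, of n v] by blast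
  have "representation Basis (w 0) b = 0" for b
  proof -
    define p where "p = (\<Sum>i\<le>n. monom (representation Basis (w i) b) i)"
    have poly_p: "poly p t = representation Basis (\<Sum>i\<le>n. t ^ i *s w i) b" for t
      by (simp add: p_def poly_sum poly_monom representation_sum[OF independent_Basis]
          representation_scale[OF independent_Basis] span_Basis mult.commute)
    have "S \<subseteq> {t. poly p t = 0}"
      using zero by (auto simp: poly_p w(1)[symmetric] representation_zero)
    then have "p = 0" using inf poly_roots_finite finite_subset by blast
    then have "coeff p 0 = 0" by simp
    then show ?thesis by (simp add: p_def coeff_sum)
  qed
  then have "(\<Sum>b\<in>Basis. representation Basis (w 0) b *s b) = 0" by simp
  then show ?thesis
    using sum_representation_eq[OF independent_Basis, of "w 0" Basis] finite_Basis span_Basis w(2) by simp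
qed


text \<open>Components exist by the span condition and are unique by independence; uniqueness then
  makes the component maps linear.\<close>

lemma direct_sum_projections:
  assumes fin: "finite I" and ind: "indep_family I W" and sub: "\<And>i. i \<in> I \<Longrightarrow> subspace (W i)"
    and span: "span (\<Union>i\<in>I. W i) = UNIV"
  obtains P where "\<And>i. i \<in> I \<Longrightarrow> endo (P i)" "\<And>i v. i \<in> I \<Longrightarrow> P i v \<in> W i"
    "\<And>v. (\<Sum>i\<in>I. P i v) = v" "\<And>i v. i \<in> I \<Longrightarrow> v \<in> W i \<Longrightarrow> P i v = v"
    "\<And>i j v. i \<in> I \<Longrightarrow> j \<in> I \<Longrightarrow> i \<noteq> j \<Longrightarrow> v \<in> W j \<Longrightarrow> P i v = 0"
proof -
  let ?D = "{v. \<exists>f. (\<forall>i\<in>I. f i \<in> W i) \<and> sum f I = v}"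
  have "subspace ?D"
  proof (rule subspaceI)
    show "0 \<in> ?D" using sub subspace_0 by (auto intro!: exI[of _ "\<lambda>_. 0"])
    show "x + y \<in> ?D" if "x \<in> ?D" "y \<in> ?D" for x y
    proof -
      obtain f g where "\<forall>i\<in>I. f i \<in> W i" "sum f I = x" "\<forall>i\<in>I. g i \<in> W i" "sum g I = y" using \<open>x \<in> ?D\<close> \<open>y \<in> ?D\<close> by blast
      then show ?thesis using sub
        by (auto intro!: exI[of _ "\<lambda>i. f i + g i"] subspace_add simp: sum.distrib)
    qed
    show "c *s x \<in> ?D" if "x \<in> ?D" for c x
    proof -
      obtain f where "\<forall>i\<in>I. f i \<in> W i" "sum f I = x" using \<open>x \<in> ?D\<close> by blast
      then show ?thesis using sub
        by (auto intro!: exI[of _ "\<lambda>i. c *s f i"] subspace_scale simp: scale_sum_right)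
    qed
  qed
  moreover have "(\<Union>i\<in>I. W i) \<subseteq> ?D"
  proof
    fix v assume "v \<in> (\<Union>i\<in>I. W i)"
    then obtain j where "j \<in> I" "v \<in> W j" by blast
    then show "v \<in> ?D" using fin sub subspace_0
      by (auto intro!: exI[of _ "\<lambda>i. if i = j then v else 0"])
  qed
  ultimately have "span (\<Union>i\<in>I. W i) \<subseteq> ?D" by (intro span_minimal)
  then have "?D = UNIV" unfolding span by (rule top.extremum_uniqueI)
  then have "\<forall>v. \<exists>f. (\<forall>i\<in>I. f i \<in> W i) \<and> sum f I = v" by blast
  then obtain f where f: "\<And>v i. i \<in> I \<Longrightarrow> f v i \<in> W i" "\<And>v. sum (f v) I = v" by metis
  have uniq: "f v i = g i" if "\<And>i. i \<in> I \<Longrightarrow> g i \<in> W i" "sum g I = v" "i \<in> I" for v g i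
  proof -
    have "f v i - g i = 0"
      by (rule indep_familyD[OF ind fin order_refl, of "\<lambda>i. f v i - g i"])
        (use that f sub in \<open>auto intro: subspace_diff simp: sum_subtractf\<close>)
    then show ?thesis by simp
  qed
  show ?thesis
  proof (rule that[of "\<lambda>i v. f v i"])
    show "endo (\<lambda>v. f v i)" if "i \<in> I" for i
      by (intro endoI uniq that)
        (use f sub in \<open>auto intro: subspace_add subspace_scale simp: sum.distrib scale_sum_right[symmetric]\<close>)
    show "f v i = v" if "i \<in> I" "v \<in> W i" for i v
      using uniq[of "\<lambda>j. if j = i then v else 0" v i] that fin sub subspace_0 by auto
    show "f v i = 0" if "i \<in> I" "j \<in> I" "i \<noteq> j" "v \<in> W j" for i j v
      using uniq[of "\<lambda>l. if l = j then v else 0" v i] that fin sub subspace_0 by auto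
  qed (use f in auto)
qed

subsection \<open>Trace\<close>

definition trace :: "('b \<Rightarrow> 'b) \<Rightarrow> 'a" where
  "trace T = (\<Sum>b\<in>Basis. representation Basis (T b) b)"

lemma coord_add: "representation Basis (u + v) b = representation Basis u b + representation Basis v b"
  and coord_diff: "representation Basis (u - v) b = representation Basis u b - representation Basis v b"
  and coord_scale: "representation Basis (c *s v) b = c * representation Basis v b"
  and coord_sum: "representation Basis (\<Sum>i\<in>A. f i) b = (\<Sum>i\<in>A. representation Basis (f i) b)"
  by (simp_all add: representation_add representation_diff representation_scale representation_sum
      independent_Basis span_Basis)

lemma sum_coord: "(\<Sum>b\<in>Basis. representation Basis v b *s b) = v"
  by (rule sum_representation_eq) (simp_all add: independent_Basis span_Basis finite_Basis)

lemma trace_add: "trace (\<lambda>v. S v + T v) = trace S + trace T"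
  by (simp add: trace_def coord_add sum.distrib)

lemma trace_diff: "trace (\<lambda>v. S v - T v) = trace S - trace T"
  by (simp add: trace_def coord_diff sum_subtractf)

lemma trace_scale: "trace (\<lambda>v. c *s T v) = c * trace T"
  by (simp add: trace_def coord_scale sum_distrib_left)

lemma trace_zero: "trace (\<lambda>v. 0) = 0"
  by (simp add: trace_def representation_zero)

lemma trace_sum: "trace (\<lambda>v. \<Sum>i\<in>A. T i v) = (\<Sum>i\<in>A. trace (T i))"
  unfolding trace_def coord_sum by (rule sum.swap)

text \<open>Both traces are the same double sum of products of matrix entries.\<close>

lemma trace_commute:
  assumes S: "endo S" and T: "endo T"
  shows "trace (\<lambda>v. S (T v)) = trace (\<lambda>v. T (S v))"
proof -
  have expand: "trace (\<lambda>v. S (T v))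
      = (\<Sum>b\<in>Basis. \<Sum>c\<in>Basis. representation Basis (T b) c * representation Basis (S c) b)"
    if S: "endo S" for S T
  proof -
    have "S (T b) = (\<Sum>c\<in>Basis. representation Basis (T b) c *s S c)" for b
      using arg_cong[OF sum_coord[of "T b"], of S] by (simp add: endo_sum[OF S] endo_scale[OF S])
    then show ?thesis unfolding trace_def by (simp add: coord_sum coord_scale)
  qed
  show ?thesis unfolding expand[OF S] expand[OF T] by (subst sum.swap) (simp add: mult.commute)
qed

text \<open>With \<open>Q j\<close> a projection onto the image of \<open>N ^^ j\<close>, cyclicity of the trace gives
  \<open>tr (N \<circ> Q j) = tr (N \<circ> Q (j + 1))\<close>.\<close>

lemma trace_nilpotent:
  assumes N: "endo N" and nil: "\<And>v. \<exists>k. (N ^^ k) v = 0"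
  shows "trace N = 0"
proof -
  have "\<exists>p. endo p \<and> (\<forall>v. p v \<in> range (N ^^ j)) \<and> (\<forall>v\<in>range (N ^^ j). p v = v)" for j
    using linear_projection_exists[OF subspace_endo_image[OF endo_funpow[OF N] subspace_UNIV]] by metis
  then obtain Q where Q: "\<And>j. endo (Q j)" "\<And>j v. Q j v \<in> range (N ^^ j)"
    "\<And>j v. v \<in> range (N ^^ j) \<Longrightarrow> Q j v = v" by metis
  have step: "trace (\<lambda>v. N (Q j v)) = trace (\<lambda>v. N (Q (Suc j) v))" for j
  proof -
    have 1: "Q (Suc j) (N (Q j v)) = N (Q j v)" for v
      using Q(2)[of j v] by (intro Q(3)) (auto simp: image_iff)
    have "range (N ^^ Suc j) \<subseteq> range (N ^^ j)" by (auto simp: funpow_swap1)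
    then have 2: "Q j (Q (Suc j) v) = Q (Suc j) v" for v
      using Q(2)[of "Suc j" v] by (intro Q(3)) (rule subsetD)
    have "trace (\<lambda>v. N (Q j v)) = trace (\<lambda>v. Q (Suc j) (N (Q j v)))" by (simp add: 1)
    also have "\<dots> = trace (\<lambda>v. N (Q j (Q (Suc j) v)))"
      by (rule trace_commute[OF Q(1) endo_comp[OF N Q(1)]])
    finally show ?thesis by (simp add: 2)
  qed
  have all: "trace (\<lambda>v. N (Q 0 v)) = trace (\<lambda>v. N (Q j v))" for j
    by (induction j) (simp_all add: step[symmetric])
  have "trace N = trace (\<lambda>v. N (Q 0 v))" using Q(3)[of _ 0] by simp
  also note all[of dimension]
  also have "(\<lambda>v. N (Q dimension v)) = (\<lambda>v. 0)"
  proof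
    fix v
    obtain w where "Q dimension v = (N ^^ dimension) w" using Q(2)[of dimension v] by blast
    moreover have "(N ^^ dimension) w = 0" using nil[of w] funpow_dim_zero[OF N] by blast
    ultimately show "N (Q dimension v) = 0" by (simp add: endo_zero[OF N])
  qed
  finally show ?thesis by (simp add: trace_zero)
qed

text \<open>Rank-one operators allow the trace of a projection to be read off a basis of its image
  instead of \<open>Basis\<close>.\<close>

lemma trace_rank_one:
  assumes "\<And>x y. \<phi> (x + y) = \<phi> x + \<phi> y" "\<And>c x. \<phi> (c *s x) = c * \<phi> x"
  shows "trace (\<lambda>v. \<phi> v *s w) = \<phi> w"
proof -
  have zero: "\<phi> 0 = 0" using assms(2)[of 0 0] by simp
  have phi_sum: "\<phi> (sum f A) = (\<Sum>i\<in>A. \<phi> (f i))" for f and A :: "'b set"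
    by (induction A rule: infinite_finite_induct) (simp_all add: zero assms(1))
  have "\<phi> w = (\<Sum>b\<in>Basis. representation Basis w b * \<phi> b)"
    using arg_cong[OF sum_coord[of w], of \<phi>] by (simp add: phi_sum assms(2))
  then show ?thesis by (simp add: trace_def coord_scale mult.commute)
qed

text \<open>In a basis \<open>B\<close> of \<open>W\<close>, \<open>P\<close> is a sum of rank-one
  operators; the one belonging to \<open>b\<close> has as trace the \<open>b\<close>-coordinate of
  \<open>P b = b\<close>, namely 1.\<close>

lemma trace_projection:
  assumes P: "endo P" and W: "subspace W" and PW: "\<And>v. P v \<in> W" "\<And>v. v \<in> W \<Longrightarrow> P v = v"
  shows "trace P = of_nat (dim W)"
proof -
  obtain B where B: "B \<subseteq> W" "independent B" "W \<subseteq> span B" "card B = dim W"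
    using basis_exists[of W] by blast
  have fin: "finite B" using B(2) by (rule finiteI_independent)
  have Pspan: "P v \<in> span B" for v using PW B by blast
  have "trace P = trace (\<lambda>v. \<Sum>b\<in>B. representation B (P v) b *s b)"
    using sum_representation_eq[OF B(2) Pspan fin order_refl] by simp
  also have "\<dots> = (\<Sum>b\<in>B. trace (\<lambda>v. representation B (P v) b *s b))" by (rule trace_sum)
  also have "\<dots> = (\<Sum>b\<in>B. representation B (P b) b)"
    by (intro sum.cong refl trace_rank_one)
      (simp_all add: endo_add[OF P] endo_scale[OF P] representation_add[OF B(2)]
        representation_scale[OF B(2)] Pspan)
  also have "\<dots> = (\<Sum>b\<in>B. 1)"
    using B(1) PW(2) by (intro sum.cong refl) (auto simp: representation_basis[OF B(2)] subset_iff)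
  finally show ?thesis using B(4) by simp
qed

text \<open>Composing with a projection onto \<open>W\<close> expresses the trace of
  \<open>D\<close> on \<open>W\<close> by an operator on the whole space. Inside \<open>W\<close>
  the composite iterates like \<open>D\<close>, so it is nilpotent everywhere.\<close>

lemma trace_nilpotent_on:
  assumes D: "endo D" "D ` W \<subseteq> W" "\<And>w. w \<in> W \<Longrightarrow> \<exists>k. (D ^^ k) w = 0"
    and P: "endo P" "\<And>v. P v \<in> W" "\<And>v. v \<in> W \<Longrightarrow> P v = v"
  shows "trace (\<lambda>v. D (P v)) = 0"
proof (rule trace_nilpotent[OF endo_comp[OF D(1) P(1)]])
  fix v
  have on_W: "((\<lambda>v. D (P v)) ^^ k) w = (D ^^ k) w" if "w \<in> W" for k w
    using that funpow_stable[OF D(2)] P(3) by (induction k) auto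
  \<comment> \<open>The innermost step sees only \<open>P v\<close>, so \<open>v\<close> may be
    replaced by its projection into \<open>W\<close>.\<close>
  have first: "((\<lambda>v. D (P v)) ^^ Suc k) v = ((\<lambda>v. D (P v)) ^^ Suc k) (P v)" for k
    using P by (simp only: funpow_Suc_right o_apply)
  obtain k where "(D ^^ k) (P v) = 0" using D(3) P(2) by blast
  then have "(D ^^ Suc k) (P v) = 0" by (simp add: endo_zero[OF D(1)])
  then have "((\<lambda>v. D (P v)) ^^ Suc k) v = 0" unfolding first on_W[OF P(2)] .
  then show "\<exists>k. ((\<lambda>v. D (P v)) ^^ k) v = 0" by blast
qed

end

section \<open>Finite-dimensional Lie algebras\<close>

locale fd_lie_algebra = finite_dimensional_vector_space scale Basis
  for scale :: "'k::field_char_0 \<Rightarrow> 'g::ab_group_add \<Rightarrow> 'g" (infixr \<open>*s\<close> 75) and Basis +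
  fixes br :: "'g \<Rightarrow> 'g \<Rightarrow> 'g"
  assumes lie: "lie_algebra scale br"
begin

section \<open>Elementary identities for the bracket\<close>

lemma br_add_left: "br (a + b) c = br a c + br b c"
  and br_add_right: "br a (b + c) = br a b + br a c"
  and br_scale_left: "br (r *s a) b = r *s br a b"
  and br_scale_right: "br a (r *s b) = r *s br a b"
  and br_self: "br a a = 0"
  using lie unfolding lie_algebra_def by blast+

lemma endo_br: "endo (br a)" and endo_br_left: "endo (\<lambda>a. br a b)"
  by (intro endoI; simp add: br_add_left br_add_right br_scale_left br_scale_right)+

lemmas br_zero_right = endo_zero[OF endo_br]
  and br_zero_left = endo_zero[OF endo_br_left]
  and br_diff_right = endo_diff[OF endo_br]
  and br_diff_left = endo_diff[OF endo_br_left]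
  and br_neg_right = endo_neg[OF endo_br]
  and br_sum_right = endo_sum[OF endo_br]
  and br_sum_left = endo_sum[OF endo_br_left]

lemma br_antisym: "br a b = - br b a"
proof -
  have "br a b + br b a = br (a + b) (a + b)" by (simp add: br_add_left br_add_right br_self[of a] br_self[of b])
  then have "br a b + br b a = 0" by (simp only: br_self)
  then show ?thesis by (simp add: eq_neg_iff_add_eq_0)
qed

lemma br_leibniz: "br a (br b c) = br (br a b) c + br b (br a c)"
proof -
  have "br a (br b c) + br b (br c a) + br c (br a b) = 0"
    using lie unfolding lie_algebra_def by blast
  moreover have "br b (br c a) = - br b (br a c)" using br_antisym[of c a] br_neg_right by simp
  moreover have "br c (br a b) = - br (br a b) c" by (rule br_antisym)
  ultimately show ?thesis by (simp add: algebra_simps)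
qed

lemma br_br_left: "br (br a b) c = br a (br b c) - br b (br a c)"
  using br_leibniz[of a b c] by simp

lemma mem_geneig_0: "v \<in> geneig T 0 \<longleftrightarrow> (\<exists>k. (T ^^ k) v = 0)"
  by (simp add: geneig_def)

text \<open>As \<open>br u\<close> is a derivation, \<open>br u - (a + b)\<close> sends
  \<open>br v w\<close> to a sum of two brackets, one with \<open>br u - a\<close> applied to
  \<open>v\<close>, the other with \<open>br u - b\<close> applied to \<open>w\<close>. Each lowers
  one of the two nilpotency exponents.\<close>

lemma geneig_br:
  assumes "v \<in> geneig (br u) a" "w \<in> geneig (br u) b"
  shows "br v w \<in> geneig (br u) (a + b)"
proof -
  let ?N = "\<lambda>c v. br u v - c *s v"
  have N: "endo (?N c)" for c by (rule endo_shift[OF endo_br])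
  have step: "?N (a + b) (br v w) = br (?N a v) w + br v (?N b w)" for v w
    by (simp add: br_leibniz[of u v w] br_diff_left br_diff_right br_scale_left br_scale_right
        scale_left_distrib algebra_simps)
  have "(?N (a + b) ^^ n) (br v w) = 0"
    if "(?N a ^^ k) v = 0" "(?N b ^^ l) w = 0" "k + l = n" for n k l v w
    using that
  proof (induction n arbitrary: k l v w)
    case 0
    then show ?case by (simp add: br_zero_left)
  next
    case (Suc n)
    show ?case
    proof (cases "k = 0 \<or> l = 0")
      case True
      then have "br v w = 0" using Suc.prems by (auto simp: br_zero_left br_zero_right)
      then show ?thesis by (simp only: endo_zero[OF endo_funpow[OF N]])
    next
      case False
      then obtain k' l' where kl: "k = Suc k'" "l = Suc l'" by (metis not0_implies_Suc)
      have "(?N a ^^ k') (?N a v) = 0" "(?N b ^^ l') (?N b w) = 0"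
        using Suc.prems(1,2) unfolding kl by (simp_all only: funpow_Suc_right o_apply)
      moreover have "k' + l = n" "k + l' = n" using Suc.prems(3) kl by simp_all
      ultimately have "(?N (a + b) ^^ n) (br (?N a v) w) = 0" "(?N (a + b) ^^ n) (br v (?N b w)) = 0"
        using Suc.IH Suc.prems(1,2) by blast+
      then show ?thesis
        by (simp only: funpow_Suc_right o_apply step endo_add[OF endo_funpow[OF N]] add_0)
    qed
  qed
  then show ?thesis using assms unfolding geneig_def by blast
qed

definition subalgebra :: "'g set \<Rightarrow> bool" where
  "subalgebra K \<longleftrightarrow> subspace K \<and> (\<forall>a\<in>K. \<forall>b\<in>K. br a b \<in> K)"

lemma subalgebra_geneig_0: "subalgebra (geneig (br u) 0)"
  unfolding subalgebra_def using subspace_geneig[OF endo_br] geneig_br[of _ u 0 _ 0] by simp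

text \<open>As \<open>w\<close> and itself have zero bracket, all brackets within the extension
  already fall into \<open>M\<close>.\<close>

lemma subalgebra_extend:
  assumes M: "subalgebra M" and w: "\<And>m. m \<in> M \<Longrightarrow> br m w \<in> M"
  shows "subalgebra (span (insert w M))"
  unfolding subalgebra_def
proof (intro conjI ballI subspace_span)
  have sM: "subspace M" using M by (simp add: subalgebra_def)
  have mem: "v \<in> span (insert w M) \<longleftrightarrow> (\<exists>k. v - k *s w \<in> M)" for v
    unfolding span_breakdown_eq span_eq_iff[THEN iffD2, OF sM] ..
  fix a b assume "a \<in> span (insert w M)" "b \<in> span (insert w M)"
  then obtain k l where kl: "a - k *s w \<in> M" "b - l *s w \<in> M" unfolding mem by blast
  define m n where "m = a - k *s w" and "n = b - l *s w"
  have "br a b = br (m + k *s w) (n + l *s w)" by (simp add: m_def n_def)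
  also have "\<dots> = br m n + l *s br m w - k *s br n w"
    using br_antisym[of w n]
    by (simp add: br_add_left br_add_right br_scale_left br_scale_right br_self scale_minus_right)
  also have "\<dots> \<in> M"
    using kl w M unfolding m_def[symmetric] n_def[symmetric]
    by (intro subspace_diff subspace_add subspace_scale sM) (auto simp: subalgebra_def)
  finally show "br a b \<in> span (insert w M)" by (simp add: span_base)
qed

subsection \<open>Engel's theorem\<close>

text \<open>The pair \<open>U\<close>, \<open>W\<close> replaces a quotient module, so that the
  induction on \<open>dim K\<close> can be used twice: for a maximal proper subalgebra
  \<open>M\<close> acting on \<open>K\<close> modulo \<open>M\<close>, which yields \<open>w\<close>
  with \<open>K = span (insert w M)\<close>, and for \<open>M\<close> acting on \<open>W\<close>
  modulo \<open>U\<close>.\<close>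

lemma engel_relative:
  assumes nil: "\<And>u v. \<exists>k. (br u ^^ k) v = 0"
  shows "subalgebra K \<Longrightarrow> subspace U \<Longrightarrow> subspace W \<Longrightarrow> U \<subset> W
    \<Longrightarrow> (\<And>a v. a \<in> K \<Longrightarrow> v \<in> W \<Longrightarrow> br a v \<in> W) \<Longrightarrow> (\<And>a v. a \<in> K \<Longrightarrow> v \<in> U \<Longrightarrow> br a v \<in> U)
    \<Longrightarrow> \<exists>w\<in>W - U. \<forall>a\<in>K. br a w \<in> U"
proof (induction "dim K" arbitrary: K U W rule: less_induct)
  case less
  note K = less.prems(1) and U = less.prems(2) and W = less.prems(3)
  have sK: "subspace K" using K by (simp add: subalgebra_def)
  show ?case
  proof (cases "K = {0}")
    case True
    then show ?thesis using less.prems subspace_0[OF U] by (auto simp: br_zero_left)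
  next
    case False
    let ?Q = "\<lambda>M. subalgebra M \<and> M \<subset> K"
    have "?Q {0}" using False subspace_0[OF sK] by (auto simp: subalgebra_def br_self)
    moreover have "\<forall>M. ?Q M \<longrightarrow> dim M < Suc dimension" using dim_subset_UNIV by (simp add: less_Suc_eq_le)
    ultimately obtain M where M: "subalgebra M" "M \<subset> K"
      and max: "\<And>M'. subalgebra M' \<Longrightarrow> M' \<subset> K \<Longrightarrow> dim M' \<le> dim M"
      using ex_has_greatest_nat[of ?Q "{0}" dim "Suc dimension"] by blast
    have sM: "subspace M" using M(1) by (simp add: subalgebra_def)
    have dimM: "dim M < dim K" using subspace_psubset_dim[OF sM sK M(2)] .
    have "\<exists>w\<in>K - M. \<forall>m\<in>M. br m w \<in> M"
      by (rule less.hyps[OF dimM M(1) sM sK M(2)]) (use M K in \<open>auto simp: subalgebra_def\<close>)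
    then obtain w where w: "w \<in> K" "w \<notin> M" "\<And>m. m \<in> M \<Longrightarrow> br m w \<in> M" by blast
    have "span (insert w M) \<subseteq> K" using w M sK by (intro span_minimal) auto
    moreover have "dim M < dim (span (insert w M))"
      using w span_base by (intro subspace_psubset_dim sM subspace_span) blast
    ultimately have Keq: "K = span (insert w M)"
      using max[OF subalgebra_extend[OF M(1) w(3)]] by fastforce
    \<comment> \<open>The vectors that \<open>M\<close> kills modulo \<open>U\<close>; they are
      stable under \<open>br w\<close> because \<open>br m w\<close> lies in
      \<open>M\<close>.\<close>
    define W' where "W' = {v \<in> W. \<forall>m\<in>M. br m v \<in> U}"
    have "\<exists>v\<in>W - U. \<forall>m\<in>M. br m v \<in> U"
      by (rule less.hyps[OF dimM M(1) U W less.prems(4)]) (use less.prems(5,6) M(2) in auto)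
    then obtain v0 where v0: "v0 \<in> W" "v0 \<notin> U" "\<forall>m\<in>M. br m v0 \<in> U" by blast
    have stab: "br w v \<in> W'" if "v \<in> W'" for v
    proof -
      have "br m (br w v) \<in> U" if "m \<in> M" for m
      proof -
        have "br (br m w) v \<in> U" "br m v \<in> U" using that w(3) \<open>v \<in> W'\<close> unfolding W'_def by blast+
        then show ?thesis
          unfolding br_leibniz[of m w v] using less.prems(6) w(1) U by (blast intro: subspace_add)
      qed
      then show ?thesis using that less.prems(5) w(1) unfolding W'_def by blast
    qed
    have W'pow: "(br w ^^ j) v0 \<in> W'" for j
      by (induction j) (use v0 stab in \<open>auto simp: W'_def\<close>)
    obtain k where "(br w ^^ k) v0 = 0" using nil by blast
    then have "\<exists>k. (br w ^^ k) v0 \<in> U" using subspace_0[OF U] by metis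
    moreover define j where "j = (LEAST k. (br w ^^ k) v0 \<in> U)"
    ultimately have jU: "(br w ^^ j) v0 \<in> U" by (metis LeastI)
    then have "j \<noteq> 0" using v0 by (metis funpow_0)
    then obtain i where i: "j = Suc i" by (metis not0_implies_Suc)
    \<comment> \<open>The last iterate of \<open>v0\<close> outside \<open>U\<close> is sent into
      \<open>U\<close> by \<open>w\<close> as well as by \<open>M\<close>.\<close>
    define v where "v = (br w ^^ i) v0"
    have v: "v \<notin> U" "br w v \<in> U" "v \<in> W'"
      using not_less_Least[of i "\<lambda>k. (br w ^^ k) v0 \<in> U"] jU W'pow i unfolding j_def v_def by auto
    have "br a v \<in> U" if "a \<in> K" for a
    proof -
      obtain c where c: "a - c *s w \<in> M"
        using \<open>a \<in> K\<close> unfolding Keq span_breakdown_eq span_eq_iff[THEN iffD2, OF sM] by blast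
      then have "br (a - c *s w) v + c *s br w v \<in> U"
        using v U by (intro subspace_add subspace_scale) (auto simp: W'_def)
      then show ?thesis by (simp add: br_diff_left br_scale_left)
    qed
    then show ?thesis using v by (auto simp: W'_def)
  qed
qed

corollary engel_center:
  assumes "\<And>u v. \<exists>k. (br u ^^ k) v = 0" "(w0 :: 'g) \<noteq> 0"
  obtains w where "w \<noteq> 0" "\<And>a. br a w = 0"
  using engel_relative[OF assms(1), of UNIV "{0}" UNIV] assms(2)
  by (auto simp: subalgebra_def br_zero_right)

subsection \<open>Regular elements\<close>

text \<open>Let \<open>x\<close> have a generalized null space \<open>H\<close> of least dimension,
  and let \<open>u\<close> be in \<open>H\<close>. For almost all \<open>t\<close>,
  \<open>br (u + t *s x)\<close> is injective modulo \<open>H\<close>; its generalized null space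
  then lies in \<open>H\<close> and equals \<open>H\<close> by minimality. The polynomial argument
  carries nilpotency on \<open>H\<close> over to \<open>t = 0\<close>.\<close>

lemma regular_element_exists:
  obtains x where "\<And>u v. u \<in> geneig (br x) 0 \<Longrightarrow> v \<in> geneig (br x) 0 \<Longrightarrow> v \<in> geneig (br u) 0"
proof -
  obtain x where min: "\<And>y. dim (geneig (br x) 0) \<le> dim (geneig (br y) 0)"
    using ex_has_least_nat[of "\<lambda>_. True" 0 "\<lambda>y. dim (geneig (br y) 0)"] by blast
  let ?H = "geneig (br x) 0"
  have sH: "subspace ?H" by (rule subspace_geneig[OF endo_br])
  have xH: "x \<in> ?H" by (rule geneig_eigenvector) (simp add: br_self)
  obtain p where p: "endo p" "\<And>v. p v \<in> ?H" "\<And>v. v \<in> ?H \<Longrightarrow> p v = v"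
    using linear_projection_exists[OF sH] by blast
  have "v \<in> geneig (br u) 0" if u: "u \<in> ?H" and v: "v \<in> ?H" for u v
  proof -
    \<comment> \<open>On the complement \<open>?M\<close> of \<open>H\<close>, \<open>?A\<close> and
      the negative of \<open>?B\<close> represent \<open>br u\<close> and \<open>br x\<close> modulo
      \<open>H\<close>; the equation \<open>?A w = t *s ?B w\<close> says that
      \<open>br (u + t *s x) w\<close> lies in \<open>H\<close>.\<close>
    let ?A = "\<lambda>w. br u w - p (br u w)" and ?B = "\<lambda>w. p (br x w) - br x w"
    let ?M = "{w. p w = 0}"
    let ?bad = "{t. \<exists>w\<in>?M. w \<noteq> 0 \<and> ?A w = t *s ?B w}"
    have "finite ?bad"
    proof (rule finite_pencil_eigenvalues)
      show "endo ?A" "endo ?B" by (intro endo_minus endo_comp[OF p(1)] endo_br)+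
      show "subspace ?M" by (rule subspace_endo_kernel[OF p(1)])
      fix w assume w: "w \<in> ?M" "?B w = 0"
      then have "br x w \<in> ?H" using p(2)[of "br x w"] by simp
      then obtain k where "(br x ^^ k) (br x w) = 0" unfolding mem_geneig_0 by blast
      then have "(br x ^^ Suc k) w = 0" by (simp add: funpow_swap1)
      then have "w \<in> ?H" unfolding mem_geneig_0 by blast
      then show "w = 0" using w p(3) by simp
    qed
    then have inf: "infinite (- ?bad)"
      unfolding Compl_eq_Diff_UNIV by (rule Diff_infinite_finite[OF _ infinite_UNIV_char_0])
    have "(br u ^^ dimension) v = 0"
    proof (rule pencil_nilpotent_at_zero[OF endo_br endo_br inf])
      fix t assume t: "t \<in> - ?bad"
      let ?y = "u + t *s x"
      have br_y: "br ?y = (\<lambda>w. br u w + t *s br x w)" by (auto simp: br_add_left br_scale_left)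
      have yH: "?y \<in> ?H" using u xH sH by (intro subspace_add subspace_scale)
      \<comment> \<open>As \<open>H\<close> is a subalgebra containing \<open>?y\<close>,
        subtracting \<open>p w\<close> reduces the claim to a vector of \<open>?M\<close>.\<close>
      have pull: "w \<in> ?H" if "br ?y w \<in> ?H" for w
      proof -
        let ?w = "w - p w"
        have "br ?y (p w) \<in> ?H"
          using subalgebra_geneig_0[of x] yH p(2) unfolding subalgebra_def by blast
        then have "br ?y ?w \<in> ?H" unfolding br_diff_right using that sH by (blast intro: subspace_diff)
        then have "p (br ?y ?w) = br ?y ?w" by (rule p(3))
        then have "?A ?w = t *s ?B ?w"
          unfolding br_y by (simp add: endo_add[OF p(1)] endo_scale[OF p(1)] scale_right_diff_distrib algebra_simps)
        moreover have "?w \<in> ?M" using p by (simp add: endo_diff[OF p(1)])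
        ultimately have "?w = 0" using t by blast
        then show ?thesis using p(2)[of w] by simp
      qed
      have pull_pow: "(br ?y ^^ k) w \<in> ?H \<Longrightarrow> w \<in> ?H" for k w
        using pull by (induction k) auto
      have "geneig (br ?y) 0 \<subseteq> ?H"
        using pull_pow subspace_0[OF sH] unfolding mem_geneig_0[of _ "br ?y"] subset_iff by metis
      then have "geneig (br ?y) 0 = ?H"
        by (intro subspace_dim_equal subspace_geneig endo_br min)
      then obtain k where "(br ?y ^^ k) v = 0" using v mem_geneig_0 by blast
      then have "(br ?y ^^ dimension) v = 0" by (rule funpow_dim_zero[OF endo_br])
      then show "((\<lambda>w. br u w + t *s br x w) ^^ dimension) v = 0" unfolding br_y .
    qed
    then show ?thesis unfolding mem_geneig_0 by blast
  qed
  then show ?thesis using that by blast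
qed

end

section \<open>The Killing form and its invariance\<close>

context fd_lie_algebra
begin

definition killing :: "'g \<Rightarrow> 'g \<Rightarrow> 'k" where
  "killing a b = trace (\<lambda>v. br a (br b v))"

lemma killing_commute: "killing a b = killing b a"
  unfolding killing_def by (rule trace_commute[OF endo_br endo_br])

lemma killing_add_left: "killing (a + b) c = killing a c + killing b c"
  by (simp add: killing_def br_add_left trace_add)

lemma killing_scale_left: "killing (r *s a) b = r * killing a b"
  by (simp add: killing_def br_scale_left trace_scale)

lemma killing_add_right: "killing a (b + c) = killing a b + killing a c"
  using killing_add_left killing_commute by metis

lemma killing_scale_right: "killing a (r *s b) = r * killing a b"
  using killing_scale_left killing_commute by metis

lemma killing_zero_right: "killing a 0 = 0"
  using killing_scale_right[of a 0 0] by simp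

lemma killing_sum_right: "killing a (\<Sum>i\<in>I. f i) = (\<Sum>i\<in>I. killing a (f i))"
  by (induction I rule: infinite_finite_induct) (simp_all add: killing_zero_right killing_add_right)

text \<open>After expanding both brackets as commutators, the two sides differ only by a cyclic
  permutation of three operators.\<close>

lemma killing_invariant: "killing (br a b) c = killing a (br b c)"
proof -
  have "trace (\<lambda>v. br b (br a (br c v))) = trace (\<lambda>v. br a (br c (br b v)))"
    using trace_commute[OF endo_br endo_comp[OF endo_br endo_br]] .
  then show ?thesis unfolding killing_def br_br_left br_diff_right trace_diff by simp
qed

end

section \<open>Root space decomposition with respect to a regular element\<close>

text \<open>The assumption \<open>regular\<close> is what \<open>regular_element_exists\<close>
  provides: the generalized null space of \<open>br x\<close> acts nilpotently on itself and takes
  the part of a Cartan subalgebra.\<close>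

locale cartan_decomposition = fd_lie_algebra scale Basis br
  for scale :: "'k::field_char_0 \<Rightarrow> 'g::ab_group_add \<Rightarrow> 'g" (infixr \<open>*s\<close> 75) and Basis br +
  fixes x :: 'g
  assumes alg_closed: "alg_closed TYPE('k)"
    and regular: "u \<in> geneig (br x) 0 \<Longrightarrow> v \<in> geneig (br x) 0 \<Longrightarrow> v \<in> geneig (br u) 0"
begin

definition H :: "'g set" where
  "H = geneig (br x) 0"

text \<open>Here \<open>\<chi>\<close> may be any function; traces show later that weights are
  linear on \<open>H\<close>.\<close>

definition root_space :: "('g \<Rightarrow> 'k) \<Rightarrow> 'g set" where
  "root_space \<chi> = {v. \<forall>u\<in>H. v \<in> geneig (br u) (\<chi> u)}"

text \<open>Weights are functions on the whole space, normalized to vanish outside \<open>H\<close>; the zero weight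
  is included.\<close>

definition roots :: "('g \<Rightarrow> 'k) set" where
  "roots = {\<chi>. (\<forall>u. u \<notin> H \<longrightarrow> \<chi> u = 0) \<and> root_space \<chi> \<noteq> {0}}"

lemma x_in_H: "x \<in> H"
  unfolding H_def by (rule geneig_eigenvector) (simp add: br_self)

lemma subspace_H: "subspace H"
  unfolding H_def by (rule subspace_geneig[OF endo_br])

lemma subspace_root_space: "subspace (root_space \<chi>)"
  unfolding root_space_def using subspace_geneig[OF endo_br] by (auto simp: subspace_def)

text \<open>One inclusion holds because \<open>x\<close> is in \<open>H\<close>, the other is
  regularity.\<close>

lemma root_space_zero: "root_space (\<lambda>_. 0) = H"
  using regular x_in_H unfolding root_space_def H_def by auto

lemma root_space_br:
  "v \<in> root_space \<beta> \<Longrightarrow> w \<in> root_space \<gamma> \<Longrightarrow> br v w \<in> root_space (\<lambda>u. \<beta> u + \<gamma> u)"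
  unfolding root_space_def using geneig_br by blast

lemma root_space_stable: "u \<in> H \<Longrightarrow> v \<in> root_space \<chi> \<Longrightarrow> br u v \<in> root_space \<chi>"
  using root_space_br[of u "\<lambda>_. 0" v \<chi>] by (simp add: root_space_zero)

lemma root_space_shift_stable:
  assumes "u \<in> H" "v \<in> root_space \<chi>"
  shows "br u v - c *s v \<in> root_space \<chi>" "br u v + c *s v \<in> root_space \<chi>"
  by (rule subspace_diff[OF subspace_root_space] subspace_add[OF subspace_root_space],
      rule root_space_stable[OF assms], rule subspace_scale[OF subspace_root_space assms(2)])+

lemma roots_outside: "\<chi> \<in> roots \<Longrightarrow> u \<notin> H \<Longrightarrow> \<chi> u = 0"
  by (simp add: roots_def)

lemma rootsI: "(\<And>u. u \<notin> H \<Longrightarrow> \<chi> u = 0) \<Longrightarrow> v \<in> root_space \<chi> \<Longrightarrow> v \<noteq> 0 \<Longrightarrow> \<chi> \<in> roots"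
  unfolding roots_def by blast

lemma rootsE:
  assumes "\<chi> \<in> roots"
  obtains v where "v \<in> root_space \<chi>" "v \<noteq> 0"
  using assms subspace_0[OF subspace_root_space[of \<chi>]] unfolding roots_def by blast

text \<open>If some \<open>u\<close> in \<open>H\<close> has no single generalized eigenvalue on
  \<open>W\<close>, then \<open>W\<close> splits into smaller pieces, which are again stable under
  \<open>H\<close> because \<open>H\<close> lies in \<open>geneig (br u) 0\<close>. Otherwise
  \<open>W\<close> lies in one weight space.\<close>

lemma root_spaces_span_stable:
  "subspace W \<Longrightarrow> (\<And>u v. u \<in> H \<Longrightarrow> v \<in> W \<Longrightarrow> br u v \<in> W) \<Longrightarrow> W \<subseteq> span (\<Union>\<chi>\<in>roots. root_space \<chi>)"
proof (induction "dim W" arbitrary: W rule: less_induct)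
  case less
  show ?case
  proof (cases "\<forall>u\<in>H. \<exists>c. W \<subseteq> geneig (br u) c")
    case True
    then obtain \<chi> where \<chi>: "\<And>u. u \<in> H \<Longrightarrow> W \<subseteq> geneig (br u) (\<chi> u)" by metis
    \<comment> \<open>Extension by zero meets the normalization in \<open>roots\<close>.\<close>
    let ?\<chi> = "\<lambda>u. if u \<in> H then \<chi> u else 0"
    have WV: "W \<subseteq> root_space ?\<chi>" using \<chi> unfolding root_space_def by auto
    show ?thesis
    proof
      fix v assume v: "v \<in> W"
      show "v \<in> span (\<Union>\<chi>\<in>roots. root_space \<chi>)"
      proof (cases "v = 0")
        case False
        then have "?\<chi> \<in> roots" using WV v by (intro rootsI) auto
        then show ?thesis using WV v by (intro span_base) blast
      qed (simp add: span_zero)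
    qed
  next
    case False
    then obtain u where u: "u \<in> H" "\<And>c. \<not> W \<subseteq> geneig (br u) c" by blast
    have piece: "W \<inter> geneig (br u) c \<subseteq> span (\<Union>\<chi>\<in>roots. root_space \<chi>)" for c
    proof (rule less.hyps)
      show sub: "subspace (W \<inter> geneig (br u) c)"
        by (intro subspace_inter less.prems(1) subspace_geneig endo_br)
      show "dim (W \<inter> geneig (br u) c) < dim W"
        using u(2)[of c] by (intro subspace_psubset_dim sub less.prems(1)) blast
      show "br h v \<in> W \<inter> geneig (br u) c" if "h \<in> H" "v \<in> W \<inter> geneig (br u) c" for h v
        using geneig_br[of h u 0 v c] regular[of u h] u(1) less.prems(2) that unfolding H_def by auto
    qed
    have "W \<subseteq> span (\<Union>c. W \<inter> geneig (br u) c)"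
      using u(1) less.prems by (intro geneig_span[OF alg_closed endo_br]) auto
    also have "\<dots> \<subseteq> span (\<Union>\<chi>\<in>roots. root_space \<chi>)"
      using piece by (intro span_minimal subspace_span) blast
    finally show ?thesis .
  qed
qed

lemma root_spaces_span: "span (\<Union>\<chi>\<in>roots. root_space \<chi>) = UNIV"
  using root_spaces_span_stable[OF subspace_UNIV] by blast

text \<open>Distinct weights differ at some \<open>u\<close> in \<open>H\<close>, and
  \<open>br u\<close> minus the scalar \<open>\<gamma> u\<close> separates their spaces.\<close>

lemma root_spaces_indep: "indep_family roots root_space"
proof (rule indep_family_separated)
  fix \<beta> \<gamma> assume "\<beta> \<in> roots" "\<gamma> \<in> roots" "\<beta> \<noteq> \<gamma>"
  then obtain u where u: "u \<in> H" "\<beta> u \<noteq> \<gamma> u" using roots_outside by (metis ext)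
  let ?D = "\<lambda>v. br u v - \<gamma> u *s v"
  have "\<forall>\<chi>\<in>roots. ?D ` root_space \<chi> \<subseteq> root_space \<chi>"
    using root_space_shift_stable(1)[OF u(1)] by blast
  moreover have "\<forall>w\<in>root_space \<beta>. ?D w = 0 \<longrightarrow> w = 0"
    using geneig_eigenvalue_unique[OF endo_br, of _ u "\<beta> u" "\<gamma> u"] u unfolding root_space_def by auto
  moreover have "\<forall>w\<in>root_space \<gamma>. \<exists>k. (?D ^^ k) w = 0"
    using u(1) unfolding root_space_def geneig_def by blast
  ultimately show "\<exists>D. endo D \<and> (\<forall>\<chi>\<in>roots. D ` root_space \<chi> \<subseteq> root_space \<chi>)
      \<and> (\<forall>w\<in>root_space \<beta>. D w = 0 \<longrightarrow> w = 0) \<and> (\<forall>w\<in>root_space \<gamma>. \<exists>k. (D ^^ k) w = 0)"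
    using endo_shift[OF endo_br] by (intro exI[of _ ?D] conjI)
qed

lemma finite_roots: "finite roots"
  using indep_family_finite[OF root_spaces_indep] rootsE subspace_root_space by metis

text \<open>If \<open>H\<close> were \<open>{0}\<close>, then \<open>x = 0\<close>, and the
  generalized null space of the zero map is everything.\<close>

lemma zero_root: "(a :: 'g) \<noteq> 0 \<Longrightarrow> (\<lambda>_. 0) \<in> roots"
proof -
  assume a: "a \<noteq> 0"
  have "H \<noteq> {0}"
  proof
    assume "H = {0}"
    then have "x = 0" using x_in_H by simp
    then have "a \<in> H" unfolding H_def by (intro geneig_eigenvector) (simp add: br_zero_left)
    then show False using \<open>H = {0}\<close> a by simp
  qed
  then show ?thesis by (simp add: roots_def root_space_zero)
qed

end

text \<open>With the projections fixed, composing an operator with \<open>P \<beta>\<close> before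
  taking the trace isolates its diagonal block on one weight space.\<close>

locale root_projections = cartan_decomposition scale Basis br x
  for scale :: "'k::field_char_0 \<Rightarrow> 'g::ab_group_add \<Rightarrow> 'g" (infixr \<open>*s\<close> 75) and Basis br x +
  fixes P :: "('g \<Rightarrow> 'k) \<Rightarrow> 'g \<Rightarrow> 'g"
  assumes endo_P: "\<beta> \<in> roots \<Longrightarrow> endo (P \<beta>)"
    and P_in: "\<beta> \<in> roots \<Longrightarrow> P \<beta> v \<in> root_space \<beta>"
    and sum_P: "(\<Sum>\<beta>\<in>roots. P \<beta> v) = v"
    and P_id: "\<beta> \<in> roots \<Longrightarrow> v \<in> root_space \<beta> \<Longrightarrow> P \<beta> v = v"
    and P_other: "\<beta> \<in> roots \<Longrightarrow> \<gamma> \<in> roots \<Longrightarrow> \<beta> \<noteq> \<gamma> \<Longrightarrow> v \<in> root_space \<gamma> \<Longrightarrow> P \<beta> v = 0"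
begin

abbreviation mult :: "('g \<Rightarrow> 'k) \<Rightarrow> nat" where
  "mult \<beta> \<equiv> dim (root_space \<beta>)"

section \<open>Traces on weight spaces, linearity of weights, and the Killing form on
  \<open>H\<close>\<close>

lemma mult_pos: "\<beta> \<in> roots \<Longrightarrow> mult \<beta> > 0"
  using rootsE[of \<beta>] by (metis dim_eq_0 gr0I singletonD subsetD)

lemma trace_P: "\<beta> \<in> roots \<Longrightarrow> trace (P \<beta>) = of_nat (mult \<beta>)"
  by (rule trace_projection[OF endo_P subspace_root_space P_in P_id])

lemma trace_split: "endo T \<Longrightarrow> trace T = (\<Sum>\<beta>\<in>roots. trace (\<lambda>v. T (P \<beta> v)))"
proof -
  assume T: "endo T"
  have "(\<Sum>\<beta>\<in>roots. T (P \<beta> v)) = T v" for v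
    using endo_sum[OF T, of "\<lambda>\<beta>. P \<beta> v" roots] by (simp add: sum_P)
  then show ?thesis by (simp add: trace_sum[symmetric])
qed

lemma root_shift_nilpotent:
  assumes "u \<in> H" "w \<in> root_space \<beta>"
  shows "\<exists>k. ((\<lambda>v. br u v - \<beta> u *s v) ^^ k) w = 0"
  using assms unfolding root_space_def geneig_def by blast

text \<open>\<open>br u\<close> minus the scalar \<open>\<beta> u\<close> is nilpotent on the weight
  space, so only the scalar contributes.\<close>

lemma trace_br_P:
  assumes u: "u \<in> H" and \<beta>: "\<beta> \<in> roots"
  shows "trace (\<lambda>v. br u (P \<beta> v)) = \<beta> u * of_nat (mult \<beta>)"
proof -
  have "trace (\<lambda>v. br u (P \<beta> v) - \<beta> u *s P \<beta> v) = 0"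
    by (rule trace_nilpotent_on[OF endo_shift[OF endo_br] _ root_shift_nilpotent[OF u] endo_P[OF \<beta>] P_in[OF \<beta>] P_id[OF \<beta>]])
      (use root_space_shift_stable(1)[OF u] in auto)
  then show ?thesis by (simp add: trace_diff trace_scale trace_P[OF \<beta>])
qed

text \<open>The square of \<open>br u\<close> minus the scalar \<open>(\<beta> u)\<^sup>2\<close>
  factors into the commuting maps \<open>?E\<close> and \<open>?D\<close>, and \<open>?D\<close> is
  nilpotent on the weight space.\<close>

lemma trace_br_br_P:
  assumes u: "u \<in> H" and \<beta>: "\<beta> \<in> roots"
  shows "trace (\<lambda>v. br u (br u (P \<beta> v))) = (\<beta> u)\<^sup>2 * of_nat (mult \<beta>)"
proof -
  let ?D = "\<lambda>v. br u v - \<beta> u *s v" and ?E = "\<lambda>v. br u v + \<beta> u *s v"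
  have D: "endo ?D" and E: "endo ?E"
    by (intro endo_minus endo_plus endo_smult endo_ident endo_br)+
  have comm: "?D (?E v) = ?E (?D v)" for v
    by (simp add: br_add_right br_diff_right br_scale_right scale_right_distrib scale_right_diff_distrib)
  have comm': "?D ((?E ^^ k) v) = (?E ^^ k) (?D v)" for k v
    by (induction k) (simp_all only: funpow.simps o_apply id_apply comm)
  have pow: "((\<lambda>v. ?E (?D v)) ^^ k) v = (?E ^^ k) ((?D ^^ k) v)" for k v
    by (induction k) (simp_all only: funpow.simps o_apply id_apply comm')
  have "trace (\<lambda>v. ?E (?D (P \<beta> v))) = 0"
  proof (rule trace_nilpotent_on[OF endo_comp[OF E D] _ _ endo_P[OF \<beta>] P_in[OF \<beta>] P_id[OF \<beta>]])
    show "(\<lambda>v. ?E (?D v)) ` root_space \<beta> \<subseteq> root_space \<beta>"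
      using root_space_shift_stable[OF u] by (auto simp del: scale_right_diff_distrib)
    fix w assume "w \<in> root_space \<beta>"
    then obtain k where "(?D ^^ k) w = 0" using root_shift_nilpotent[OF u] by blast
    then show "\<exists>k. ((\<lambda>v. ?E (?D v)) ^^ k) w = 0"
      unfolding pow using endo_zero[OF endo_funpow[OF E]] by metis
  qed
  moreover have "?E (?D v) = br u (br u v) - (\<beta> u)\<^sup>2 *s v" for v
    by (simp add: br_diff_right br_scale_right scale_right_diff_distrib power2_eq_square)
  ultimately show ?thesis by (simp add: trace_diff trace_scale trace_P[OF \<beta>])
qed

text \<open>\<open>\<beta> u\<close> times the multiplicity is a trace and hence additive in
  \<open>u\<close>; characteristic zero permits division by the multiplicity.\<close>

lemma root_add:
  assumes "\<beta> \<in> roots" "u \<in> H" "v \<in> H"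
  shows "\<beta> (u + v) = \<beta> u + \<beta> v"
proof -
  have "\<beta> (u + v) * of_nat (mult \<beta>) = (\<beta> u + \<beta> v) * of_nat (mult \<beta>)"
    using assms subspace_add[OF subspace_H]
    by (simp add: trace_br_P[symmetric] br_add_left trace_add distrib_right)
  then show ?thesis using mult_pos[OF assms(1)] by (simp del: dim_eq_0)
qed

lemma root_scale:
  assumes "\<beta> \<in> roots" "u \<in> H"
  shows "\<beta> (c *s u) = c * \<beta> u"
proof -
  have "\<beta> (c *s u) * of_nat (mult \<beta>) = c * \<beta> u * of_nat (mult \<beta>)"
    using assms subspace_scale[OF subspace_H]
    by (simp add: trace_br_P[symmetric] br_scale_left trace_scale mult.assoc)
  then show ?thesis using mult_pos[OF assms(1)] by (simp del: dim_eq_0)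
qed

lemma root_zero: "\<beta> \<in> roots \<Longrightarrow> \<beta> 0 = 0"
  using root_scale[of \<beta> 0 0] subspace_0[OF subspace_H] by simp

lemma killing_H_square:
  assumes "h \<in> H"
  shows "killing h h = (\<Sum>\<beta>\<in>roots. (\<beta> h)\<^sup>2 * of_nat (mult \<beta>))"
  unfolding killing_def using assms
  by (simp add: trace_split[OF endo_comp[OF endo_br endo_br]] trace_br_br_P)

text \<open>Polarization of \<open>killing_H_square\<close>.\<close>

lemma killing_H:
  assumes "h \<in> H" "z \<in> H"
  shows "killing z h = (\<Sum>\<beta>\<in>roots. \<beta> z * \<beta> h * of_nat (mult \<beta>))"
proof -
  have "2 * killing z h = killing (z + h) (z + h) - killing z z - killing h h"
    by (simp add: killing_add_left killing_add_right killing_commute[of h z])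
  also have "\<dots> = (\<Sum>\<beta>\<in>roots. (\<beta> (z + h))\<^sup>2 * of_nat (mult \<beta>) - (\<beta> z)\<^sup>2 * of_nat (mult \<beta>)
      - (\<beta> h)\<^sup>2 * of_nat (mult \<beta>))"
    using assms subspace_add[OF subspace_H] by (simp add: killing_H_square sum_subtractf)
  also have "\<dots> = (\<Sum>\<beta>\<in>roots. 2 * (\<beta> z * \<beta> h * of_nat (mult \<beta>)))"
    using assms by (intro sum.cong refl) (simp add: root_add power2_eq_square algebra_simps)
  finally show ?thesis by (simp add: sum_distrib_left[symmetric])
qed

text \<open>This form covers sums of weights that may fail to be weights: their spaces are
  zero.\<close>

lemma P_root_space:
  assumes "\<beta> \<in> roots" "\<And>u. u \<notin> H \<Longrightarrow> \<gamma> u = 0" "v \<in> root_space \<gamma>"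
  shows "P \<beta> v = (if \<gamma> = \<beta> then v else 0)"
proof (cases "v = 0")
  case True
  then show ?thesis using endo_zero[OF endo_P[OF assms(1)]] by simp
next
  case False
  then have "\<gamma> \<in> roots" using assms rootsI by blast
  then show ?thesis using P_id P_other assms by auto
qed

text \<open>\<open>br z\<close> after \<open>br w\<close> shifts every weight by
  \<open>\<gamma>\<close>, so it has no diagonal blocks.\<close>

lemma killing_H_root_space:
  assumes z: "z \<in> H" and w: "w \<in> root_space \<gamma>" "\<gamma> \<in> roots" "\<gamma> \<noteq> (\<lambda>_. 0)"
  shows "killing z w = 0"
proof -
  have "trace (\<lambda>v. br z (br w (P \<beta> v))) = 0" if \<beta>: "\<beta> \<in> roots" for \<beta>
  proof -
    let ?T = "\<lambda>v. br z (br w (P \<beta> v))"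
    have T: "endo ?T" by (rule endo_comp[OF endo_br endo_comp[OF endo_br endo_P[OF \<beta>]]])
    \<comment> \<open>Cyclicity of the trace moves a second copy of \<open>P \<beta>\<close> to the
      outside, where it meets a vector of a different weight.\<close>
    have "P \<beta> (?T v) = 0" for v
    proof -
      have "?T v \<in> root_space (\<lambda>u. \<gamma> u + \<beta> u)"
        by (intro root_space_stable[OF z] root_space_br w P_in \<beta>)
      moreover have "(\<lambda>u. \<gamma> u + \<beta> u) \<noteq> \<beta>" using w(3) by (auto simp: fun_eq_iff)
      ultimately show ?thesis
        using P_root_space[OF \<beta>, of "\<lambda>u. \<gamma> u + \<beta> u"] roots_outside[OF w(2)] roots_outside[OF \<beta>] by simp
    qed
    then have "trace (\<lambda>v. ?T (P \<beta> v)) = 0"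
      using trace_commute[OF T endo_P[OF \<beta>]] by (simp add: trace_zero)
    then show ?thesis using P_id[OF \<beta> P_in[OF \<beta>]] by simp
  qed
  then show ?thesis unfolding killing_def by (simp add: trace_split[OF endo_comp[OF endo_br endo_br]])
qed

subsection \<open>Root strings\<close>

text \<open>\<open>br e\<close> sends weight \<open>\<gamma>\<close> to \<open>a + \<gamma>\<close>.
  Either both weights are in \<open>M\<close> or both are outside, or \<open>a + \<gamma>\<close> is
  no weight and the bracket is zero.\<close>

lemma br_commutes_with_projection:
  assumes M: "M \<subseteq> roots" and a: "\<And>u. u \<notin> H \<Longrightarrow> a u = 0" and e: "e \<in> root_space a"
    and closed: "\<And>\<gamma>. \<gamma> \<in> roots \<Longrightarrow> (\<lambda>u. a u + \<gamma> u) \<in> roots \<Longrightarrow> (\<lambda>u. a u + \<gamma> u) \<in> M \<longleftrightarrow> \<gamma> \<in> M"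
  shows "br e (\<Sum>\<beta>\<in>M. P \<beta> v) = (\<Sum>\<beta>\<in>M. P \<beta> (br e v))"
proof -
  have finM: "finite M" using M finite_roots finite_subset by blast
  have on_spaces: "(\<Sum>\<beta>\<in>M. P \<beta> (br e w)) = (if \<gamma> \<in> M then br e w else 0)"
    if w: "w \<in> root_space \<gamma>" "\<gamma> \<in> roots" for w \<gamma>
  proof -
    let ?\<delta> = "\<lambda>u. a u + \<gamma> u"
    have \<delta>: "br e w \<in> root_space ?\<delta>" "\<And>u. u \<notin> H \<Longrightarrow> ?\<delta> u = 0"
      using root_space_br[OF e w(1)] a roots_outside[OF w(2)] by auto
    have "(\<Sum>\<beta>\<in>M. P \<beta> (br e w)) = (\<Sum>\<beta>\<in>M. if ?\<delta> = \<beta> then br e w else 0)"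
      using M \<delta> by (intro sum.cong refl P_root_space) auto
    also have "\<dots> = (if ?\<delta> \<in> M then br e w else 0)" using finM by (simp add: sum.delta')
    also have "\<dots> = (if \<gamma> \<in> M then br e w else 0)"
      using closed[OF w(2)] rootsI[OF \<delta>(2,1)] M by (cases "br e w = 0") auto
    finally show ?thesis .
  qed
  have "br e v = (\<Sum>\<gamma>\<in>roots. br e (P \<gamma> v))" by (simp add: sum_P br_sum_right[symmetric])
  then have "(\<Sum>\<beta>\<in>M. P \<beta> (br e v)) = (\<Sum>\<beta>\<in>M. \<Sum>\<gamma>\<in>roots. P \<beta> (br e (P \<gamma> v)))"
    using M by (intro sum.cong refl) (auto simp: endo_sum[OF endo_P])
  also have "\<dots> = (\<Sum>\<gamma>\<in>roots. if \<gamma> \<in> M then br e (P \<gamma> v) else 0)"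
    using on_spaces[OF P_in] by (subst sum.swap) (intro sum.cong refl, blast)
  also have "\<dots> = (\<Sum>\<gamma>\<in>M. br e (P \<gamma> v))"
    using M finite_roots by (simp add: sum.If_cases Int_absorb1)
  finally show ?thesis by (simp add: br_sum_right)
qed

text \<open>The trace of \<open>ad [e, f]\<close> vanishes on the sum of the root spaces along the
  \<open>l\<close>-string through \<open>m\<close>.\<close>

lemma root_string_rational:
  assumes l: "l \<in> roots" and m: "m \<in> roots"
    and e: "e \<in> root_space l" and f: "f \<in> root_space (\<lambda>u. - l u)"
  shows "\<exists>r::rat. m (br e f) = of_rat r * l (br e f)"
proof -
  \<comment> \<open>Gaps are allowed: all weights differing from \<open>m\<close> by an integer
    multiple of \<open>l\<close> are taken.\<close>
  define M where "M = {\<beta> \<in> roots. \<exists>n::int. \<beta> = (\<lambda>u. m u + of_int n * l u)}"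
  have M: "M \<subseteq> roots" "finite M" using finite_roots by (auto simp: M_def)
  have "m \<in> M" using m unfolding M_def by (auto intro: exI[of _ 0])
  have "br e f \<in> root_space (\<lambda>u. l u + - l u)" by (rule root_space_br[OF e f])
  then have hH: "br e f \<in> H" by (simp add: root_space_zero)
  let ?Q = "\<lambda>v. \<Sum>\<beta>\<in>M. P \<beta> v"
  have Q: "endo ?Q" using M by (intro endo_sumI endo_P) auto
  have "(\<lambda>u. l u + \<gamma> u) \<in> M \<longleftrightarrow> \<gamma> \<in> M" if "\<gamma> \<in> roots" "(\<lambda>u. l u + \<gamma> u) \<in> roots" for \<gamma>
  proof
    assume "(\<lambda>u. l u + \<gamma> u) \<in> M"
    then obtain n :: int where "(\<lambda>u. l u + \<gamma> u) = (\<lambda>u. m u + of_int n * l u)" unfolding M_def by blast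
    then have "\<gamma> = (\<lambda>u. m u + of_int (n - 1) * l u)"
      by (simp add: fun_eq_iff algebra_simps)
    then show "\<gamma> \<in> M" using that unfolding M_def by blast
  next
    assume "\<gamma> \<in> M"
    then obtain n :: int where "\<gamma> = (\<lambda>u. m u + of_int n * l u)" unfolding M_def by blast
    then have "(\<lambda>u. l u + \<gamma> u) = (\<lambda>u. m u + of_int (n + 1) * l u)" by (simp add: fun_eq_iff algebra_simps)
    then show "(\<lambda>u. l u + \<gamma> u) \<in> M" using that unfolding M_def by blast
  qed
  then have Qe: "br e (?Q v) = ?Q (br e v)" for v
    using br_commutes_with_projection[OF M(1) roots_outside[OF l] e] by blast
  have "trace (\<lambda>v. br f (br e (?Q v))) = trace (\<lambda>v. br f (?Q (br e v)))" by (simp add: Qe)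
  also have "\<dots> = trace (\<lambda>v. br e (br f (?Q v)))"
    by (rule trace_commute[OF endo_comp[OF endo_br Q] endo_br])
  finally have "trace (\<lambda>v. br (br e f) (?Q v)) = 0" by (simp add: br_br_left trace_diff)
  moreover have "trace (\<lambda>v. br (br e f) (?Q v)) = (\<Sum>\<beta>\<in>M. \<beta> (br e f) * of_nat (mult \<beta>))"
    using M by (simp add: br_sum_right trace_sum trace_br_P[OF hH] subset_iff cong: sum.cong)
  ultimately have sum_zero: "(\<Sum>\<beta>\<in>M. \<beta> (br e f) * of_nat (mult \<beta>)) = 0" by simp
  have "\<forall>\<beta>\<in>M. \<exists>n::int. \<beta> (br e f) = m (br e f) + of_int n * l (br e f)" unfolding M_def by auto
  then obtain n :: "('g \<Rightarrow> 'k) \<Rightarrow> int"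
    where n: "\<forall>\<beta>\<in>M. \<beta> (br e f) = m (br e f) + of_int (n \<beta>) * l (br e f)" by (rule bchoice[THEN exE])
  have "(\<Sum>\<beta>\<in>M. (m (br e f) + of_int (n \<beta>) * l (br e f)) * of_nat (mult \<beta>)) = 0"
    unfolding sum_zero[symmetric] using n by (intro sum.cong refl) simp
  \<comment> \<open>\<open>D\<close> is the total dimension of the string and \<open>z\<close>
    collects the multiples of \<open>l\<close>; the vanishing trace becomes an integer relation
    between \<open>m\<close> and \<open>l\<close> at \<open>br e f\<close>.\<close>
  moreover define D where "D = (\<Sum>\<beta>\<in>M. mult \<beta>)"
  moreover define z where "z = (\<Sum>\<beta>\<in>M. n \<beta> * int (mult \<beta>))"
  ultimately have "m (br e f) * of_nat D + of_int z * l (br e f) = 0"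
    by (simp add: D_def z_def distrib_right sum.distrib sum_distrib_left sum_distrib_right distrib_left mult_ac)
  moreover have "D > 0"
    unfolding D_def using M \<open>m \<in> M\<close> mult_pos by (intro sum_pos) auto
  ultimately have "m (br e f) = of_rat (- of_int z / of_nat D) * l (br e f)"
    by (simp add: of_rat_divide of_rat_minus field_simps eq_neg_iff_add_eq_0)
  then show ?thesis by blast
qed

end

section \<open>Consequences of a vanishing Killing form\<close>

context root_projections
begin

text \<open>All weights at \<open>br e f\<close> are rational multiples of
  \<open>l (br e f)\<close>, so \<open>killing\<close> there is a sum of nonnegative rationals times
  the square of that value. Its vanishing makes the value or all the rationals zero.\<close>

lemma roots_vanish_on_brackets:
  assumes K: "\<And>a. killing a a = 0" and l: "l \<in> roots" and m: "m \<in> roots"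
    and e: "e \<in> root_space l" and f: "f \<in> root_space (\<lambda>u. - l u)"
  shows "m (br e f) = 0"
proof -
  let ?h = "br e f"
  have "?h \<in> root_space (\<lambda>u. l u + - l u)" by (rule root_space_br[OF e f])
  then have hH: "?h \<in> H" by (simp add: root_space_zero)
  have "\<forall>\<beta>\<in>roots. \<exists>r::rat. \<beta> ?h = of_rat r * l ?h" using root_string_rational[OF l _ e f] by blast
  then obtain r :: "('g \<Rightarrow> 'k) \<Rightarrow> rat" where r: "\<And>\<beta>. \<beta> \<in> roots \<Longrightarrow> \<beta> ?h = of_rat (r \<beta>) * l ?h"
    using bchoice[of roots] by metis
  have "0 = (\<Sum>\<beta>\<in>roots. (\<beta> ?h)\<^sup>2 * of_nat (mult \<beta>))" using killing_H_square[OF hH] K by simp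
  also have "\<dots> = (\<Sum>\<beta>\<in>roots. of_rat ((r \<beta>)\<^sup>2 * of_nat (mult \<beta>)) * (l ?h)\<^sup>2)"
  proof (rule sum.cong[OF refl])
    fix \<beta> assume "\<beta> \<in> roots"
    then have "(\<beta> ?h)\<^sup>2 = (of_rat (r \<beta>) * l ?h)\<^sup>2" using r by simp
    then show "(\<beta> ?h)\<^sup>2 * of_nat (mult \<beta>) = of_rat ((r \<beta>)\<^sup>2 * of_nat (mult \<beta>)) * (l ?h)\<^sup>2"
      by (simp add: of_rat_mult of_rat_power power_mult_distrib)
  qed
  also have "\<dots> = of_rat (\<Sum>\<beta>\<in>roots. (r \<beta>)\<^sup>2 * of_nat (mult \<beta>)) * (l ?h)\<^sup>2"
    by (simp add: of_rat_sum sum_distrib_right)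
  finally have "(\<Sum>\<beta>\<in>roots. (r \<beta>)\<^sup>2 * of_nat (mult \<beta>)) = 0 \<or> l ?h = 0" by simp
  moreover have "r l = 0" if "(\<Sum>\<beta>\<in>roots. (r \<beta>)\<^sup>2 * of_nat (mult \<beta>)) = 0"
    using that l mult_pos[OF l] by (subst (asm) sum_nonneg_eq_0_iff[OF finite_roots]) (auto simp del: dim_eq_0)
  ultimately have "l ?h = 0" using r[OF l] by auto
  then show ?thesis using r[OF m] by simp
qed

text \<open>Extended to the whole space by projecting onto \<open>H\<close>, \<open>m\<close> is
  linear. It kills every bracket of weight vectors: such a bracket has a component in
  \<open>H\<close> only for opposite weights, where \<open>roots_vanish_on_brackets\<close>
  applies.\<close>

lemma roots_trivial_if_killing_zero:
  assumes K: "\<And>a. killing a a = 0" and perfect: "span {br a b |a b. True} = UNIV"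
    and m: "m \<in> roots" and zero: "(\<lambda>_. 0) \<in> roots"
  shows "m = (\<lambda>_. 0)"
proof -
  let ?P = "P (\<lambda>_. 0)"
  have P_H: "?P v \<in> H" for v using P_in[OF zero] by (simp add: root_space_zero)
  note endoP = endo_P[OF zero]
  have m_sum: "m (?P (\<Sum>i\<in>A. f i)) = (\<Sum>i\<in>A. m (?P (f i)))" for f and A :: "('g \<Rightarrow> 'k) set"
    by (induction A rule: infinite_finite_induct)
      (simp_all add: endo_zero[OF endoP] endo_add[OF endoP] root_zero[OF m] root_add[OF m] P_H)
  let ?Z = "{v. m (?P v) = 0}"
  have "subspace ?Z"
    by (rule subspaceI)
      (simp_all add: endo_zero[OF endoP] endo_add[OF endoP] endo_scale[OF endoP] root_zero[OF m]
        root_add[OF m] root_scale[OF m] P_H)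
  moreover have "br a b \<in> ?Z" for a b
  proof -
    have piece: "m (?P (br (P \<gamma> a) (P \<delta> b))) = 0" if \<gamma>: "\<gamma> \<in> roots" and \<delta>: "\<delta> \<in> roots" for \<gamma> \<delta>
    proof -
      let ?s = "\<lambda>u. \<gamma> u + \<delta> u"
      have s: "br (P \<gamma> a) (P \<delta> b) \<in> root_space ?s" by (intro root_space_br P_in \<gamma> \<delta>)
      have Ps: "?P (br (P \<gamma> a) (P \<delta> b)) = (if ?s = (\<lambda>_. 0) then br (P \<gamma> a) (P \<delta> b) else 0)"
        using roots_outside[OF \<gamma>] roots_outside[OF \<delta>] by (intro P_root_space[OF zero _ s]) simp
      show ?thesis
      proof (cases "?s = (\<lambda>_. 0)")
        case True
        then have "\<delta> = (\<lambda>u. - \<gamma> u)" by (auto simp: fun_eq_iff eq_neg_iff_add_eq_0 add.commute)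
        then have "P \<delta> b \<in> root_space (\<lambda>u. - \<gamma> u)" using P_in[OF \<delta>] by simp
        then have "m (br (P \<gamma> a) (P \<delta> b)) = 0"
          by (rule roots_vanish_on_brackets[OF K \<gamma> m P_in[OF \<gamma>]])
        then show ?thesis using Ps True by simp
      next
        case False
        then show ?thesis using Ps root_zero[OF m] by simp
      qed
    qed
    have "br a b = (\<Sum>\<gamma>\<in>roots. \<Sum>\<delta>\<in>roots. br (P \<gamma> a) (P \<delta> b))"
      by (simp add: br_sum_left[symmetric] br_sum_right[symmetric] sum_P)
    then have "m (?P (br a b)) = (\<Sum>\<gamma>\<in>roots. \<Sum>\<delta>\<in>roots. m (?P (br (P \<gamma> a) (P \<delta> b))))"
      by (simp only: m_sum)
    then show ?thesis using piece by simp
  qed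
  then have "{br a b |a b. True} \<subseteq> ?Z" by blast
  ultimately have "span {br a b |a b. True} \<subseteq> ?Z" by (intro span_minimal)
  then have "m (?P v) = 0" for v unfolding perfect by blast
  then have "m v = 0" if "v \<in> H" for v using P_id[OF zero, of v] that by (metis root_space_zero)
  then show ?thesis using roots_outside[OF m] by blast
qed

end

section \<open>Two elements with trivial common centralizer\<close>

context fd_lie_algebra
begin

lemma simple_perfect:
  assumes "simple_lie_algebra scale br"
  shows "span {br a b |a b. True} = UNIV"
proof -
  have "lie_ideal scale br (span {br a b |a b. True})"
    unfolding lie_ideal_def by (auto intro: span_base)
  moreover obtain a b where "br a b \<noteq> 0" using assms unfolding simple_lie_algebra_def by blast
  then have "span {br a b |a b. True} \<noteq> {0}" using span_base[of "br a b" "{br a b |a b. True}"] by auto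
  ultimately show ?thesis using assms unfolding simple_lie_algebra_def by blast
qed

lemma simple_center_trivial:
  assumes "simple_lie_algebra scale br" "\<And>a. br a w = 0"
  shows "w = 0"
proof -
  let ?C = "{w. \<forall>a. br a w = 0}"
  have "lie_ideal scale br ?C"
    unfolding lie_ideal_def subspace_def by (simp add: br_zero_right br_add_right br_scale_right)
  moreover have "?C \<noteq> UNIV" using assms(1) unfolding simple_lie_algebra_def by blast
  ultimately have "?C = {0}" using assms(1) unfolding simple_lie_algebra_def by blast
  then show ?thesis using assms(2) by blast
qed

text \<open>By invariance the radical of the form is an ideal.\<close>

lemma killing_nondegenerate_if_nonzero:
  assumes simple: "simple_lie_algebra scale br" and nz: "killing a b \<noteq> 0"
    and z: "\<And>v. killing z v = 0"
  shows "z = 0"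
proof -
  let ?R = "{z. \<forall>v. killing z v = 0}"
  have "killing (br u y) v = 0" if "\<forall>v. killing y v = 0" for u y v
    using that killing_invariant[of v u y] killing_commute by (metis killing_invariant killing_commute br_antisym)
  moreover have "subspace ?R"
    using killing_scale_left[of 0 0]
    by (intro subspaceI) (simp_all add: killing_add_left killing_scale_left)
  ultimately have "lie_ideal scale br ?R" unfolding lie_ideal_def by blast
  moreover have "?R \<noteq> UNIV" using nz by blast
  ultimately have "?R = {0}" using simple unfolding simple_lie_algebra_def by blast
  then show ?thesis using z by blast
qed

text \<open>A nondegenerate form represents every linear functional, in particular a nonzero one
  vanishing on \<open>S\<close>.\<close>

lemma proper_subspace_killing_orthogonal:
  assumes nondeg: "\<And>z. (\<And>v. killing z v = 0) \<Longrightarrow> z = 0" and S: "subspace S" "S \<noteq> UNIV"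
  obtains z where "z \<noteq> 0" "\<And>s. s \<in> S \<Longrightarrow> killing z s = 0"
proof -
  obtain p where p: "endo p" "\<And>v. p v \<in> S" "\<And>v. v \<in> S \<Longrightarrow> p v = v"
    using linear_projection_exists[OF S(1)] by blast
  let ?q = "\<lambda>v. v - p v"
  obtain w where w: "w \<notin> S" using S(2) by blast
  then have "?q w \<noteq> 0" using p(2)[of w] by auto
  then obtain c where c: "representation Basis (?q w) c \<noteq> 0"
    using sum_coord[of "?q w"] by (metis (no_types, lifting) scale_zero_left sum.neutral)
  \<comment> \<open>A coordinate of the part complementary to \<open>S\<close>: it vanishes on
    \<open>S\<close> but not at \<open>w\<close>.\<close>
  define f where "f v = representation Basis (?q v) c" for v
  have f_sum: "f v = (\<Sum>b\<in>Basis. representation Basis v b * f b)" for v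
  proof -
    have q: "endo ?q" by (intro endo_minus endo_ident p)
    have "?q v = (\<Sum>b\<in>Basis. representation Basis v b *s ?q b)"
      using arg_cong[OF sum_coord[of v], of ?q] unfolding endo_sum[OF q] endo_scale[OF q] by simp
    then show ?thesis unfolding f_def by (simp only: coord_sum coord_scale)
  qed
  \<comment> \<open>\<open>?F z\<close> records the functional \<open>killing z\<close> by its
    values on \<open>Basis\<close>; injectivity comes from nondegeneracy and implies
    surjectivity.\<close>
  let ?F = "\<lambda>z. \<Sum>b\<in>Basis. killing z b *s b"
  have F: "endo ?F"
    by (intro endoI) (simp_all add: killing_add_left killing_scale_left scale_left_distrib sum.distrib scale_sum_right)
  have coordF: "representation Basis (?F z) b = killing z b" if "b \<in> Basis" for z b
    using that finite_Basis
    by (simp add: coord_sum coord_scale representation_basis[OF independent_Basis] if_distrib sum.delta cong: if_cong)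
  have kill_expand: "killing z v = (\<Sum>b\<in>Basis. representation Basis v b * killing z b)" for z v
    using arg_cong[OF sum_coord[of v], of "killing z"] by (simp add: killing_sum_right killing_scale_right)
  have "inj ?F"
  proof (rule injI)
    fix y z assume eq: "?F y = ?F z"
    have "killing (y - z) b = 0" if "b \<in> Basis" for b
      using coordF[OF that, of y] coordF[OF that, of z] eq killing_add_left[of "y - z" z b] by simp
    then have "killing (y - z) v = 0" for v unfolding kill_expand[of "y - z" v] by simp
    then show "y = z" using nondeg[of "y - z"] by simp
  qed
  have "surj ?F" using linear_inj_imp_surj[OF F \<open>inj ?F\<close>] .
  then obtain z where z: "?F z = (\<Sum>b\<in>Basis. f b *s b)" by (rule surjE[OF _ that, OF _ sym])
  have "killing z b = f b" if "b \<in> Basis" for b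
    using coordF[OF that, of z] that finite_Basis unfolding z
    by (simp add: coord_sum coord_scale representation_basis[OF independent_Basis] if_distrib sum.delta cong: if_cong)
  then have kz: "killing z v = f v" for v unfolding kill_expand[of z v] f_sum[of v] by simp
  have "killing z w \<noteq> 0" using c kz by (simp add: f_def)
  then have "z \<noteq> 0" using killing_scale_left[of 0 0 w] by auto
  moreover have "killing z s = 0" if "s \<in> S" for s
    using p(3)[OF that] by (simp add: kz f_def representation_zero)
  ultimately show ?thesis using that by blast
qed

text \<open>By invariance, a vector orthogonal to all \<open>br x a + br y b\<close> centralizes
  \<open>x\<close> and \<open>y\<close>, so a trivial common centralizer suffices.\<close>

lemma simple_two_element_bracket_span:
  assumes ac: "alg_closed TYPE('k)" and simple: "simple_lie_algebra scale br"
  obtains x y where "\<And>v. \<exists>a b. v = br x a + br y b"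
proof -
  obtain x where "\<And>u v. u \<in> geneig (br x) 0 \<Longrightarrow> v \<in> geneig (br x) 0 \<Longrightarrow> v \<in> geneig (br u) 0"
    using regular_element_exists by blast
  then interpret cartan_decomposition scale Basis br x
    using ac by unfold_locales
  obtain P where P: "\<And>i. i \<in> roots \<Longrightarrow> endo (P i)" "\<And>i v. i \<in> roots \<Longrightarrow> P i v \<in> root_space i"
    "\<And>v. (\<Sum>i\<in>roots. P i v) = v" "\<And>i v. i \<in> roots \<Longrightarrow> v \<in> root_space i \<Longrightarrow> P i v = v"
    "\<And>i j v. i \<in> roots \<Longrightarrow> j \<in> roots \<Longrightarrow> i \<noteq> j \<Longrightarrow> v \<in> root_space j \<Longrightarrow> P i v = 0"
    using direct_sum_projections[OF finite_roots root_spaces_indep subspace_root_space root_spaces_span] by blast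
  interpret root_projections scale Basis br x P
    by unfold_locales (use P in \<open>auto simp: endo_add[OF P(1)] endo_scale[OF P(1)]\<close>)
  obtain a0 b0 where ab0: "br a0 b0 \<noteq> 0" using simple unfolding simple_lie_algebra_def by blast
  note zero = zero_root[OF ab0]
  have "\<exists>a. killing a a \<noteq> 0"
  proof (rule ccontr)
    assume "\<not> (\<exists>a. killing a a \<noteq> 0)"
    then have "roots = {\<lambda>_. 0}"
      using roots_trivial_if_killing_zero[OF _ simple_perfect[OF simple] _ zero] zero by blast
    \<comment> \<open>With only the zero weight, every element is ad-nilpotent, and Engel's theorem
      produces a nonzero central element.\<close>
    then have "H = UNIV" 
      using root_spaces_span span_eq_iff[THEN iffD2, OF subspace_H] by (simp add: root_space_zero)
    then have "v \<in> geneig (br u) 0" for u v using regular[of u v] unfolding H_def by simp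
    then have "\<exists>k. (br u ^^ k) v = 0" for u v unfolding mem_geneig_0 .
    then obtain w where "w \<noteq> 0" "\<And>a. br a w = 0" using engel_center ab0 by blast
    then show False using simple_center_trivial[OF simple] by blast
  qed
  then have nondeg: "\<And>z. (\<And>v. killing z v = 0) \<Longrightarrow> z = 0"
    using killing_nondegenerate_if_nonzero[OF simple] by blast
  have "\<forall>\<beta>\<in>roots. \<exists>v. v \<in> root_space \<beta> \<and> v \<noteq> 0" using rootsE by metis
  then obtain g where g: "\<And>\<beta>. \<beta> \<in> roots \<Longrightarrow> g \<beta> \<in> root_space \<beta>" "\<And>\<beta>. \<beta> \<in> roots \<Longrightarrow> g \<beta> \<noteq> 0"
    by metis
  define y where "y = (\<Sum>\<beta>\<in>roots. g \<beta>)"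
  have centralizer: "z = 0" if zx: "br x z = 0" and zy: "br z y = 0" for z
  proof (rule nondeg)
    have zH: "z \<in> H" unfolding H_def using zx by (intro geneig_eigenvector) simp
    have "(\<Sum>\<beta>\<in>roots. br z (g \<beta>)) = 0" using zy unfolding y_def br_sum_right .
    \<comment> \<open>The summands lie in different weight spaces, hence vanish separately; so
      \<open>g \<beta>\<close> is an eigenvector of \<open>br z\<close> for 0, which forces
      \<open>\<beta> z = 0\<close>.\<close>
    then have "br z (g \<beta>) = 0" if "\<beta> \<in> roots" for \<beta>
      using indep_familyD[OF root_spaces_indep finite_roots order_refl, of "\<lambda>\<beta>. br z (g \<beta>)" \<beta>]
        root_space_stable[OF zH g(1)] that by blast
    then have vanish: "\<beta> z = 0" if "\<beta> \<in> roots" for \<beta>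
      using geneig_eigenvalue_unique[OF endo_br, of "g \<beta>" z "\<beta> z" 0] g[OF that] zH that
      unfolding root_space_def by auto
    fix v
    have "killing z (P \<beta> v) = 0" if \<beta>: "\<beta> \<in> roots" for \<beta>
    proof (cases "\<beta> = (\<lambda>_. 0)")
      case True
      then have "P \<beta> v \<in> H" using P_in[OF \<beta>, of v] root_space_zero by simp
      then show ?thesis using vanish by (subst killing_H[OF _ zH]) (auto intro: sum.neutral)
    next
      case False
      then show ?thesis using killing_H_root_space[OF zH P_in[OF \<beta>] \<beta>] by blast
    qed
    then have "killing z (\<Sum>\<beta>\<in>roots. P \<beta> v) = 0" by (simp add: killing_sum_right)
    then show "killing z v = 0" by (simp add: sum_P)
  qed
  let ?S = "{v. \<exists>a b. v = br x a + br y b}"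
  have "subspace {u + v |u v. u \<in> range (br x) \<and> v \<in> range (br y)}"
    by (intro subspace_sums subspace_endo_image endo_br subspace_UNIV)
  moreover have "{u + v |u v. u \<in> range (br x) \<and> v \<in> range (br y)} = ?S" by blast
  ultimately have "subspace ?S" by simp
  have "?S = UNIV"
  proof (rule ccontr)
    assume "?S \<noteq> UNIV"
    then obtain z where z: "z \<noteq> 0" "\<And>s. s \<in> ?S \<Longrightarrow> killing z s = 0"
      using proper_subspace_killing_orthogonal[OF nondeg \<open>subspace ?S\<close>] by blast
    have "br x a + br y 0 \<in> ?S" "br x 0 + br y a \<in> ?S" for a by blast+
    then have "br x a \<in> ?S" "br y a \<in> ?S" for a by (simp_all only: br_zero_right add_0_left add_0_right)
    then have "killing (br z x) a = 0" "killing (br z y) a = 0" for a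
      using z(2) by (simp_all add: killing_invariant)
    then have "br z x = 0" "br z y = 0" using nondeg by blast+
    then show False using centralizer[of z] z(1) br_antisym[of x z] by simp
  qed
  then show ?thesis using that[of x y] by blast
qed

end

section \<open>Current Lie algebras\<close>

lemma tensor_rels_diff:
  "p \<in> tensor_rels sg sA \<Longrightarrow> q \<in> tensor_rels sg sA \<Longrightarrow> p - q \<in> tensor_rels sg sA"
  using tensor_rels.plus[of p sg sA "- q"] tensor_rels.uminus[of q sg sA] by simp

text \<open>Summing over a common finite superset of the keys makes brackets of different
  representatives comparable term by term.\<close>

lemma current_bracket_single_left:
  assumes "finite K" "Poly_Mapping.keys q \<subseteq> K"
  shows "current_bracket br (Poly_Mapping.single (x, e) 1) q
    = (\<Sum>v\<in>K. Poly_Mapping.single (br x (fst v), e * snd v) (Poly_Mapping.lookup q v))"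
  unfolding current_bracket_def using assms
  by (auto intro!: sum.mono_neutral_left simp: in_keys_iff)

lemma current_bracket_single_diff:
  "current_bracket br (Poly_Mapping.single (x, e) 1) (p - q)
    = current_bracket br (Poly_Mapping.single (x, e) 1) p - current_bracket br (Poly_Mapping.single (x, e) 1) q"
proof -
  let ?K = "Poly_Mapping.keys p \<union> Poly_Mapping.keys q"
  have "Poly_Mapping.keys (p - q) \<subseteq> ?K" by (auto simp: in_keys_iff lookup_minus)
  then show ?thesis
    by (simp add: current_bracket_single_left[of ?K] lookup_minus single_diff sum_subtractf)
qed

text \<open>Bracketing with \<open>x \<otimes> e\<close> is additive on representatives, so it
  suffices to treat a generator \<open>v \<otimes> a\<close>. With
  \<open>v = br x s + br y t\<close>, the partners are \<open>s \<otimes> a\<close> and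
  \<open>t \<otimes> a\<close>.\<close>

lemma tensor_sum_of_two_brackets:
  assumes span: "\<And>v. \<exists>a b. v = br x a + br y b" and e: "\<And>a. e * a = a"
  shows "\<exists>q r. tensor_eq sg sA p (current_bracket br (Poly_Mapping.single (x, e) 1) q
      + current_bracket br (Poly_Mapping.single (y, e) 1) r)"
proof -
  let ?B = "\<lambda>x. current_bracket br (Poly_Mapping.single (x, e) 1)"
  have "Poly_Mapping.keys p \<subseteq> UNIV" by simp
  then have "\<exists>q r. p - (?B x q + ?B y r) \<in> tensor_rels sg sA"
  proof (induction p rule: frag_induction)
    case zero
    have "(0 :: ('a \<times> 'b) \<Rightarrow>\<^sub>0 int) - (?B x 0 + ?B y 0) = 0" by (simp add: current_bracket_def)
    then show ?case using tensor_rels.zero by metis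
  next
    case (one u)
    obtain v a where u: "u = (v, a)" by force
    obtain s t where st: "v = br x s + br y t" using span by blast
    have "Poly_Mapping.single (v, a) 1
        - (?B x (Poly_Mapping.single (s, a) 1) + ?B y (Poly_Mapping.single (t, a) 1))
      = Poly_Mapping.single (br x s + br y t, a) 1 - Poly_Mapping.single (br x s, a) 1
          - Poly_Mapping.single (br y t, a) (1::int)"
      by (simp add: st current_bracket_def e)
    also have "\<dots> \<in> tensor_rels sg sA" by (rule tensor_rels.add_l)
    finally show ?case unfolding u by blast
  next
    case (diff p p')
    then obtain q r q' r' where
      "p - (?B x q + ?B y r) \<in> tensor_rels sg sA" "p' - (?B x q' + ?B y r') \<in> tensor_rels sg sA"
      by blast
    then have "(p - (?B x q + ?B y r)) - (p' - (?B x q' + ?B y r')) \<in> tensor_rels sg sA"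
      by (rule tensor_rels_diff)
    also have "(p - (?B x q + ?B y r)) - (p' - (?B x q' + ?B y r'))
        = (p - p') - (?B x (q - q') + ?B y (r - r'))"
      by (simp add: current_bracket_single_diff algebra_simps)
    finally show ?case by blast
  qed
  then show ?thesis unfolding tensor_eq_def .
qed

lemma bracket_width_le:
  assumes "\<And>z. is_sum_of_brackets eq br z n"
  shows "bracket_width eq br \<le> enat n"
  unfolding bracket_width_def bracket_length_def
  by (intro SUP_least) (simp add: Least_le assms)

theorem theorem1:
  fixes sg :: "'k::field_char_0 \<Rightarrow> 'g::ab_group_add \<Rightarrow> 'g"
    and bg :: "'g \<Rightarrow> 'g \<Rightarrow> 'g"
    and sA :: "'k \<Rightarrow> 'a::comm_ring \<Rightarrow> 'a"
  assumes "alg_closed TYPE('k)"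
    and "simple_lie_algebra sg bg"
    and "finite_dim sg"
    and "comm_unital_algebra sA"
  shows "bracket_width (tensor_eq sg sA) (current_bracket bg) \<le> 2"
proof -
  obtain Basis where "finite_dimensional_vector_space sg Basis"
    using assms(3) unfolding finite_dim_def by blast
  then interpret fd_lie_algebra sg Basis bg
    using assms(2) by (intro fd_lie_algebra.intro fd_lie_algebra_axioms.intro) (auto simp: simple_lie_algebra_def)
  obtain x y where xy: "\<And>v. \<exists>a b. v = bg x a + bg y b"
    using simple_two_element_bracket_span[OF assms(1,2)] by blast
  obtain e :: 'a where e: "\<And>a. e * a = a"
    using assms(4) unfolding comm_unital_algebra_def by blast
  have "is_sum_of_brackets (tensor_eq sg sA) (current_bracket bg) z 2" for z
  proof -
    obtain q r where "tensor_eq sg sA z (current_bracket bg (Poly_Mapping.single (x, e) 1) q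
        + current_bracket bg (Poly_Mapping.single (y, e) 1) r)"
      using tensor_sum_of_two_brackets[of bg x y e sg sA z] xy e by blast
    then show ?thesis
      unfolding is_sum_of_brackets_def
      by (intro exI[of _ "\<lambda>i. Poly_Mapping.single (if i = 0 then x else y, e) 1"]
          exI[of _ "\<lambda>i. if i = 0 then q else r"]) (simp add: numeral_2_eq_2)
  qed
  then have "bracket_width (tensor_eq sg sA) (current_bracket bg) \<le> enat 2"
    by (rule bracket_width_le)
  then show ?thesis by (simp add: numeral_eq_enat)
qed

end
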